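(* Let $\langle A;R\rangle$ be a finite presentation of a group $G$ with filling length function $\le f(\cdot)$. Then the word problem of $G$ is in $\mathrm{SymSpace}(f(\cdot))$.
   Context: $A$ is a finite alphabet, $A^{-1}$ a disjoint copy, $A^{\pm1}=A\cup A^{-1}$, $(A^{\pm1})^*$ the set of words over $A^{\pm1}$, $|w|$ the length of a word, $1$ the empty word. $R\subset(A^{\pm1})^*$ is finite and does not contain the empty word; $R^{\pm1}=R\cup\{r^{-1}:r\in R\}$. The word problem is the language of all words in $(A^{\pm1})^*$ that represent the identity of $G$. The filling length function is $\le f(\cdot)$ if every word $w$ representing the identity of $G$ can be rewritten to $1$, with all intermediate words of length $\le f(|w|)$, by the string rewriting system over $A^{\pm1}$ with rules $U_R\cup U_{\mathrm{FG}}$, where $U_R=\{u\to v:u,v\in(A^{\pm1})^*,\ uv^{-1}\in R^{\pm1}\}$ and $U_{\mathrm{FG}}=\{aa^{-1}\to1,\ 1\to aa^{-1}:a\in A^{\pm1}\}$. A symmetric Turing machine is a nondeterministic Turing machine whose transition relation is symmetric, i.e. the reverse of any transition of the machine is also a transition of the machine. $\mathrm{SymSpace}(q)$ is the class of languages accepted by symmetric Turing machines with space complexity $O(q(O(n)))$: for each accepted input of length $\le n$ there is at least one accepting computation with space at most $c_1\,q(c_2n)$ for all $n\ge c_3$, for positive constants $c_1,c_2,c_3$ depending on the machine. *)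

theory Defs
  imports "HOL-Algebra.Elementary_Groups"
begin

section \<open>Words and free groups\<close>

datatype 'a letter = Pos 'a | Neg 'a

fun inv_letter :: "'a letter \<Rightarrow> 'a letter" where
  "inv_letter (Pos a) = Neg a"
| "inv_letter (Neg a) = Pos a"

definition letters :: "'a set \<Rightarrow> 'a letter set" where
  "letters A = Pos ` A \<union> Neg ` A"

text \<open>The formal inverse; no free reduction takes place.\<close>

definition inv_word :: "'a letter list \<Rightarrow> 'a letter list" where
  "inv_word w = rev (map inv_letter w)"

definition rewrite_step :: "'b set \<Rightarrow> ('b list \<times> 'b list) set \<Rightarrow> ('b list \<times> 'b list) set" where
  "rewrite_step \<Sigma> S =
     {(x @ u @ y, x @ v @ y) | x y u v. x \<in> lists \<Sigma> \<and> y \<in> lists \<Sigma> \<and> (u, v) \<in> S}"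

definition U_FG :: "'a set \<Rightarrow> ('a letter list \<times> 'a letter list) set" where
  "U_FG A = {([a, inv_letter a], []) | a. a \<in> letters A}
          \<union> {([], [a, inv_letter a]) | a. a \<in> letters A}"

definition U_R :: "'a set \<Rightarrow> 'a letter list set \<Rightarrow> ('a letter list \<times> 'a letter list) set" where
  "U_R A R = {(u, v). u \<in> lists (letters A) \<and> v \<in> lists (letters A)
                    \<and> u @ inv_word v \<in> R \<union> inv_word ` R}"

text \<open>Since \<^term>\<open>U_FG A\<close> is symmetric, reachability is already the free equivalence.\<close>

definition free_eq :: "'a set \<Rightarrow> ('a letter list \<times> 'a letter list) set" where
  "free_eq A = (rewrite_step (letters A) (U_FG A))\<^sup>*
                 \<inter> (lists (letters A) \<times> lists (letters A))"

definition free_class :: "'a set \<Rightarrow> 'a letter list \<Rightarrow> 'a letter list set" where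
  "free_class A w = free_eq A `` {w}"

definition free_group :: "'a set \<Rightarrow> 'a letter list set monoid" where
  "free_group A =
     \<lparr> carrier = lists (letters A) // free_eq A,
       monoid.mult = (\<lambda>X Y. \<Union>x\<in>X. \<Union>y\<in>Y. free_class A (x @ y)),
       one = free_class A [] \<rparr>"

lemma inv_letter_inv_letter [simp]: "inv_letter (inv_letter a) = a"
  by (cases a) auto

lemma inv_letter_in_letters: "a \<in> letters A \<Longrightarrow> inv_letter a \<in> letters A"
  by (auto simp: letters_def)

lemma inv_word_in_lists:
  assumes "w \<in> lists (letters A)"
  shows "inv_word w \<in> lists (letters A)"
  using assms by (auto simp: inv_word_def in_lists_conv_set inv_letter_in_letters)

lemma rewrite_step_U_FG_sym:
  "(u, v) \<in> rewrite_step (letters A) (U_FG A) \<Longrightarrow> (v, u) \<in> rewrite_step (letters A) (U_FG A)"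
  unfolding rewrite_step_def U_FG_def by blast

lemma equiv_free_eq: "equiv (lists (letters A)) (free_eq A)"
proof -
  have "sym ((rewrite_step (letters A) (U_FG A))\<^sup>*)"
    by (rule sym_rtrancl) (blast intro: symI rewrite_step_U_FG_sym)
  then have "sym (free_eq A)"
    unfolding free_eq_def sym_def by blast
  moreover have "trans (free_eq A)"
    unfolding free_eq_def by (intro trans_Int trans_rtrancl) (auto simp: trans_def)
  moreover have "refl_on (lists (letters A)) (free_eq A)"
    unfolding free_eq_def refl_on_def by blast
  moreover have "free_eq A \<subseteq> lists (letters A) \<times> lists (letters A)"
    unfolding free_eq_def by blast
  ultimately show ?thesis
    by (intro equivI)
qed

lemma rewrite_step_context:
  assumes "(u, v) \<in> rewrite_step \<Sigma> S" "x \<in> lists \<Sigma>" "y \<in> lists \<Sigma>"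
  shows "(x @ u @ y, x @ v @ y) \<in> rewrite_step \<Sigma> S"
proof -
  obtain p q u' v' where "u = p @ u' @ q" "v = p @ v' @ q" "p \<in> lists \<Sigma>" "q \<in> lists \<Sigma>" "(u', v') \<in> S"
    using assms(1) unfolding rewrite_step_def by blast
  moreover from this have "x @ p \<in> lists \<Sigma>" "q @ y \<in> lists \<Sigma>"
    using assms by auto
  ultimately have "\<exists>p' q' u' v'. x @ u @ y = p' @ u' @ q' \<and> x @ v @ y = p' @ v' @ q' \<and>
      p' \<in> lists \<Sigma> \<and> q' \<in> lists \<Sigma> \<and> (u', v') \<in> S"
    by (intro exI[of _ "x @ p"] exI[of _ "q @ y"] exI[of _ u'] exI[of _ v']) auto
  then show ?thesis
    unfolding rewrite_step_def by blast
qed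

lemma rewrite_steps_context:
  assumes "(u, v) \<in> (rewrite_step \<Sigma> S)\<^sup>*" "x \<in> lists \<Sigma>" "y \<in> lists \<Sigma>"
  shows "(x @ u @ y, x @ v @ y) \<in> (rewrite_step \<Sigma> S)\<^sup>*"
  using assms(1)
proof (induction rule: rtrancl_induct)
  case base
  show ?case by simp
next
  case (step y' z)
  then show ?case
    using rewrite_step_context[OF _ assms(2,3)] by (blast intro: rtrancl_into_rtrancl)
qed

lemma free_eq_append:
  assumes "(u, u') \<in> free_eq A" "(v, v') \<in> free_eq A"
  shows "(u @ v, u' @ v') \<in> free_eq A"
proof -
  let ?S = "(rewrite_step (letters A) (U_FG A))\<^sup>*"
  have "(u @ v, u' @ v) \<in> ?S" "(u' @ v, u' @ v') \<in> ?S"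
    using assms rewrite_steps_context[of u u' _ _ "[]" v] rewrite_steps_context[of v v' _ _ u' "[]"]
    by (auto simp: free_eq_def)
  then show ?thesis
    using assms rtrancl_trans[of "u @ v" "u' @ v" _ "u' @ v'"] by (simp add: free_eq_def)
qed

lemma carrier_free_group: "carrier (free_group A) = free_class A ` lists (letters A)"
  by (auto simp: free_group_def quotient_def free_class_def)

lemma one_free_group: "\<one>\<^bsub>free_group A\<^esub> = free_class A []"
  by (simp add: free_group_def)

lemma mult_free_group:
  assumes "u \<in> lists (letters A)" "v \<in> lists (letters A)"
  shows "free_class A u \<otimes>\<^bsub>free_group A\<^esub> free_class A v = free_class A (u @ v)"
proof -
  have *: "free_class A (x @ y) = free_class A (u @ v)"
    if "x \<in> free_class A u" "y \<in> free_class A v" for x y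
  proof -
    have "(u @ v, x @ y) \<in> free_eq A"
      using that by (intro free_eq_append) (simp_all add: free_class_def)
    then show ?thesis
      unfolding free_class_def by (rule equiv_class_eq[OF equiv_free_eq, symmetric])
  qed
  have "u \<in> free_class A u" "v \<in> free_class A v"
    using assms equiv_class_self[OF equiv_free_eq] by (auto simp: free_class_def)
  moreover have "(\<Union>x\<in>free_class A u. \<Union>y\<in>free_class A v. free_class A (x @ y))
      = (\<Union>x\<in>free_class A u. \<Union>y\<in>free_class A v. free_class A (u @ v))"
    by (intro SUP_cong refl *)
  ultimately show ?thesis
    unfolding free_group_def by auto
qed

lemma free_eq_inv_word:
  assumes "w \<in> lists (letters A)"
  shows "(inv_word w @ w, []) \<in> free_eq A"
  using assms
proof (induction w rule: list.induct)
  case Nil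
  then show ?case by (simp add: free_eq_def inv_word_def)
next
  case (Cons a w)
  let ?S = "rewrite_step (letters A) (U_FG A)"
  have a: "a \<in> letters A" and w: "w \<in> lists (letters A)"
    using Cons.prems by auto
  have "([inv_letter a, a], []) \<in> U_FG A"
    using inv_letter_in_letters[OF a] unfolding U_FG_def by force
  then have "(inv_word w @ [inv_letter a, a] @ w, inv_word w @ [] @ w) \<in> ?S"
    using w inv_word_in_lists[OF w] unfolding rewrite_step_def by blast
  moreover have "(inv_word w @ w, []) \<in> ?S\<^sup>*"
    using Cons.IH[OF w] by (simp add: free_eq_def)
  ultimately have "(inv_word (a # w) @ a # w, []) \<in> ?S\<^sup>*"
    using converse_rtrancl_into_rtrancl[of "inv_word w @ [inv_letter a, a] @ w" "inv_word w @ w" ?S]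
    by (simp add: inv_word_def)
  then show ?case
    using Cons.prems inv_word_in_lists[OF Cons.prems]
    unfolding free_eq_def by (auto simp del: in_lists_conv_set)
qed

lemma group_free_group: "group (free_group A)"
proof (rule groupI, unfold carrier_free_group one_free_group)
  let ?L = "lists (letters A)" and ?F = "free_group A"
  fix x y assume "x \<in> free_class A ` ?L" "y \<in> free_class A ` ?L"
  then obtain u v where u: "u \<in> ?L" "x = free_class A u" and v: "v \<in> ?L" "y = free_class A v"
    by (elim imageE)
  then show "x \<otimes>\<^bsub>?F\<^esub> y \<in> free_class A ` ?L"
    by (simp only: mult_free_group) simp
  fix z assume "z \<in> free_class A ` ?L"
  then obtain w where "w \<in> ?L" "z = free_class A w"
    by (elim imageE)
  moreover have "u @ v \<in> ?L" "v @ w \<in> ?L"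
    using u v \<open>w \<in> ?L\<close> by simp_all
  ultimately show "x \<otimes>\<^bsub>?F\<^esub> y \<otimes>\<^bsub>?F\<^esub> z = x \<otimes>\<^bsub>?F\<^esub> (y \<otimes>\<^bsub>?F\<^esub> z)"
    using u v by (simp only: mult_free_group append_assoc)
next
  let ?L = "lists (letters A)" and ?F = "free_group A"
  show "free_class A [] \<in> free_class A ` ?L"
    by (rule imageI) simp
  fix x assume "x \<in> free_class A ` ?L"
  then obtain w where w: "w \<in> ?L" "x = free_class A w"
    by (elim imageE)
  show "free_class A [] \<otimes>\<^bsub>?F\<^esub> x = x"
    using w by (simp only: mult_free_group lists.Nil append_Nil)
  have "free_class A (inv_word w @ w) = free_class A []"
    unfolding free_class_def
    by (rule equiv_class_eq[OF equiv_free_eq free_eq_inv_word[OF w(1)]])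
  then have "free_class A (inv_word w) \<otimes>\<^bsub>?F\<^esub> x = free_class A []"
    using w inv_word_in_lists[OF w(1)] by (simp only: mult_free_group)
  then show "\<exists>y\<in>free_class A ` ?L. y \<otimes>\<^bsub>?F\<^esub> x = free_class A []"
    using inv_word_in_lists[OF w(1)] by blast
qed

definition normal_closure :: "('g, 'm) monoid_scheme \<Rightarrow> 'g set \<Rightarrow> 'g set" where
  "normal_closure G S =
     generate G {g \<otimes>\<^bsub>G\<^esub> s \<otimes>\<^bsub>G\<^esub> inv\<^bsub>G\<^esub> g | g s. g \<in> carrier G \<and> s \<in> S}"


section \<open>Presentations, word problem, filling length\<close>

text \<open>The epimorphism \<open>h\<close> from the free group onto \<open>G\<close>, with kernel the normal closure of
  the relators, is the data by which words over the generators denote elements of \<open>G\<close>.\<close>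

definition finite_presentation ::
  "'a set \<Rightarrow> 'a letter list set \<Rightarrow> ('g, 'm) monoid_scheme \<Rightarrow> ('a letter list set \<Rightarrow> 'g) \<Rightarrow> bool"
where
  "finite_presentation A R G h \<longleftrightarrow>
     finite A \<and> finite R \<and> R \<subseteq> lists (letters A) \<and> [] \<notin> R \<and>
     group G \<and> h \<in> epi (free_group A) G \<and>
     kernel (free_group A) G h = normal_closure (free_group A) (free_class A ` R)"

definition word_problem ::
  "'a set \<Rightarrow> ('g, 'm) monoid_scheme \<Rightarrow> ('a letter list set \<Rightarrow> 'g) \<Rightarrow> 'a letter list set" where
  "word_problem A G h = {w \<in> lists (letters A). h (free_class A w) = \<one>\<^bsub>G\<^esub>}"

text \<open>The length bound applies to every word of the derivation, including its first word.\<close>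

definition filling_length_le ::
  "'a set \<Rightarrow> 'a letter list set \<Rightarrow> ('g, 'm) monoid_scheme \<Rightarrow> ('a letter list set \<Rightarrow> 'g)
     \<Rightarrow> (nat \<Rightarrow> nat) \<Rightarrow> bool"
where
  "filling_length_le A R G h f \<longleftrightarrow>
     (\<forall>w \<in> word_problem A G h.
        (w, []) \<in> {(x, y) \<in> rewrite_step (letters A) (U_R A R \<union> U_FG A).
                     length x \<le> f (length w) \<and> length y \<le> f (length w)}\<^sup>*)"


section \<open>Symmetric Turing machines\<close>

text \<open>
  Machines have a single tape, infinite in both directions. Transitions are those of Lewis and
  Papadimitriou, for which the reverse of a transition is again a transition. \<open>Stay a b\<close>
  replaces the scanned symbol \<open>a\<close> by \<open>b\<close>. \<open>Move_Right a b c d\<close> applies when the head scans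
  \<open>a\<close> and the cell to its right contains \<open>b\<close>; these two cells are changed to \<open>c\<close> and \<open>d\<close>, and
  the head moves to the right one. \<open>Move_Left a b c d\<close> applies when the head scans \<open>b\<close> and the
  cell to its left contains \<open>a\<close>; these two cells, from left to right, are changed to \<open>c\<close> and
  \<open>d\<close>, and the head moves to the left one. An ordinary transition that writes \<open>c\<close> over \<open>a\<close> and
  moves right is the family of all \<open>Move_Right a b c b\<close>.

  States are natural numbers and the symbols \<open>Aux i\<close> supply auxiliary tape symbols. A machine
  has finitely many transitions, so only finitely many states and tape symbols matter.
\<close>

datatype 'b tape_symbol = Blank | Input 'b | Aux nat

datatype 's tape_action = Stay 's 's | Move_Right 's 's 's 's | Move_Left 's 's 's 's

type_synonym 'b transition = "nat \<times> 'b tape_symbol tape_action \<times> nat"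

record 'b turing_machine =
  input_alphabet :: "'b set"
  transitions :: "'b transition set"
  initial_state :: nat
  final_states :: "nat set"

definition turing_machine :: "'b turing_machine \<Rightarrow> bool" where
  "turing_machine M \<longleftrightarrow>
     finite (input_alphabet M) \<and> finite (transitions M) \<and> finite (final_states M)"

fun reverse_action :: "'s tape_action \<Rightarrow> 's tape_action" where
  "reverse_action (Stay a b) = Stay b a"
| "reverse_action (Move_Right a b c d) = Move_Left c d a b"
| "reverse_action (Move_Left a b c d) = Move_Right c d a b"

definition symmetric_turing_machine :: "'b turing_machine \<Rightarrow> bool" where
  "symmetric_turing_machine M \<longleftrightarrow>
     turing_machine M \<and>
     (\<forall>p act q. (p, act, q) \<in> transitions M \<longrightarrow> (q, reverse_action act, p) \<in> transitions M)"

text \<open>A configuration consists of the state, the head position and the tape contents.\<close>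

type_synonym 'b config = "nat \<times> int \<times> (int \<Rightarrow> 'b tape_symbol)"

definition head :: "'b config \<Rightarrow> int" where
  "head c = fst (snd c)"

fun acts :: "'s tape_action \<Rightarrow> int \<Rightarrow> (int \<Rightarrow> 's) \<Rightarrow> int \<Rightarrow> (int \<Rightarrow> 's) \<Rightarrow> bool" where
  "acts (Stay a b) i t j t' \<longleftrightarrow> t i = a \<and> j = i \<and> t' = t(i := b)"
| "acts (Move_Right a b c d) i t j t' \<longleftrightarrow>
     t i = a \<and> t (i + 1) = b \<and> j = i + 1 \<and> t' = t(i := c, i + 1 := d)"
| "acts (Move_Left a b c d) i t j t' \<longleftrightarrow>
     t (i - 1) = a \<and> t i = b \<and> j = i - 1 \<and> t' = t(i - 1 := c, i := d)"

definition tm_step :: "'b turing_machine \<Rightarrow> ('b config \<times> 'b config) set" where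
  "tm_step M = {((p, i, t), (q, j, t')) | p i t q j t'.
                  \<exists>act. (p, act, q) \<in> transitions M \<and> acts act i t j t'}"

definition initial_config :: "'b turing_machine \<Rightarrow> 'b list \<Rightarrow> 'b config" where
  "initial_config M w =
     (initial_state M, 0,
      \<lambda>i. if 0 \<le> i \<and> i < int (length w) then Input (w ! nat i) else Blank)"

definition final_configs :: "'b turing_machine \<Rightarrow> 'b config set" where
  "final_configs M = {c. fst c \<in> final_states M}"

definition accepts :: "'b turing_machine \<Rightarrow> 'b list \<Rightarrow> bool" where
  "accepts M w \<longleftrightarrow> (\<exists>c \<in> final_configs M. (initial_config M w, c) \<in> (tm_step M)\<^sup>*)"

definition accepted_language :: "'b turing_machine \<Rightarrow> 'b list set" where
  "accepted_language M = {w \<in> lists (input_alphabet M). accepts M w}"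

text \<open>
  Some accepting computation on \<open>w\<close> visits at most \<open>s\<close> tape cells: there is a set \<open>C\<close> of at most
  \<open>s\<close> cells containing the head position before and after each of its steps. These are all the
  cells that are read or written, including those of the input. A computation without any step
  uses no space.
\<close>

definition accepts_in_space :: "'b turing_machine \<Rightarrow> 'b list \<Rightarrow> nat \<Rightarrow> bool" where
  "accepts_in_space M w s \<longleftrightarrow>
     (\<exists>C. finite C \<and> card C \<le> s \<and>
        (\<exists>c \<in> final_configs M.
           (initial_config M w, c) \<in> {(c1, c2) \<in> tm_step M. head c1 \<in> C \<and> head c2 \<in> C}\<^sup>*))"

definition SymSpace :: "(nat \<Rightarrow> nat) \<Rightarrow> 'b list set set" where
  "SymSpace q =
     {L. \<exists>M. symmetric_turing_machine M \<and> accepted_language M = L \<and>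
          (\<exists>c1 > 0. \<exists>c2 > 0. \<exists>c3 > 0. \<forall>n \<ge> c3. \<forall>w \<in> L.
             length w \<le> n \<longrightarrow> accepts_in_space M w (c1 * q (c2 * n)))}"

end

theory Submission
  imports Defs "HOL-Library.Countable_Set"
begin

text \<open>
  The machine keeps a word on its tape between two end markers, with blanks interspersed; blanks
  are neutral. Its moves walk, exchange a letter or the right marker with an adjacent blank, and
  replace a block of blanks by a relator or by some \<open>a a\<^sup>-\<^sup>1\<close>. As it is symmetric, it can also
  delete these words. The replacement takes several moves, during which the state records the
  rest of the word to be written; counting this rest as part of the tape word, every
  move and every reversed move preserves the represented group element, which gives soundness. A
  rule \<open>u \<rightarrow> v\<close> with \<open>u v\<^sup>-\<^sup>1\<close> a relator is simulated by
  \<open>u \<rightarrow> u v\<^sup>-\<^sup>1 v \<rightarrow> v\<close>, at the cost of constant additional space.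
\<close>

section \<open>Reversal of tape actions and finiteness of the set of actions\<close>

text \<open>An action records both the old and the new contents of the cells it touches, so
  exchanging the two undoes it exactly.\<close>

lemma acts_reverse_action: "acts (reverse_action act) j t' i t \<longleftrightarrow> acts act i t j t'"
  by (cases act) (auto intro!: ext)

lemma reverse_action_reverse_action [simp]: "reverse_action (reverse_action act) = act"
  by (cases act) auto

lemma sym_tm_step:
  assumes "symmetric_turing_machine M"
  shows "sym (tm_step M)"
proof (rule symI)
  fix c c' assume "(c, c') \<in> tm_step M"
  then obtain p i t q j t' act where *: "c = (p, i, t)" "c' = (q, j, t')"
    "(p, act, q) \<in> transitions M" "acts act i t j t'"
    by (auto simp: tm_step_def)
  then have "(q, reverse_action act, p) \<in> transitions M" "acts (reverse_action act) j t' i t"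
    using assms by (simp_all add: symmetric_turing_machine_def acts_reverse_action)
  then show "(c', c) \<in> tm_step M"
    using * by (auto simp: tm_step_def)
qed

text \<open>An action holds at most four symbols, so finiteness of a transition set reduces to that
  of its states and tape symbols.\<close>

lemma finite_tape_actions:
  assumes "finite X"
  shows "finite {act. set_tape_action act \<subseteq> X}"
proof -
  let ?S = "(\<lambda>(a, b). Stay a b) ` (X \<times> X)"
  let ?R = "(\<lambda>(a, b, c, d). Move_Right a b c d) ` (X \<times> X \<times> X \<times> X)"
  let ?L = "(\<lambda>(a, b, c, d). Move_Left a b c d) ` (X \<times> X \<times> X \<times> X)"
  have "act \<in> ?S \<union> ?R \<union> ?L" if "set_tape_action act \<subseteq> X" for act
  proof (cases act)
    case (Stay a b)
    then have "act \<in> ?S"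
      using that by (intro image_eqI[of _ _ "(a, b)"]) auto
    then show ?thesis by blast
  next
    case (Move_Right a b c d)
    then have "act \<in> ?R"
      using that by (intro image_eqI[of _ _ "(a, b, c, d)"]) auto
    then show ?thesis by blast
  next
    case (Move_Left a b c d)
    then have "act \<in> ?L"
      using that by (intro image_eqI[of _ _ "(a, b, c, d)"]) auto
    then show ?thesis by blast
  qed
  then have "{act. set_tape_action act \<subseteq> X} \<subseteq> ?S \<union> ?R \<union> ?L"
    by blast
  then show ?thesis
    by (rule finite_subset) (use assms in auto)
qed


section \<open>Tape contents\<close>

definition support :: "(int \<Rightarrow> 'b tape_symbol) \<Rightarrow> int set" where
  "support t = {j. t j \<noteq> Blank}"

text \<open>Dropping blanks turns a half-tape into a word that does not depend on where the blanks
  lie. On infinite sets \<open>sorted_list_of_set\<close> gives \<open>[]\<close>, hence the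
  assumption of finite support in what follows.\<close>

definition left_content :: "(int \<Rightarrow> 'b tape_symbol) \<Rightarrow> int \<Rightarrow> 'b tape_symbol list" where
  "left_content t i = map t (sorted_list_of_set (support t \<inter> {..<i}))"

definition right_content :: "(int \<Rightarrow> 'b tape_symbol) \<Rightarrow> int \<Rightarrow> 'b tape_symbol list" where
  "right_content t i = map t (sorted_list_of_set (support t \<inter> {i..}))"

text \<open>A blank counts as the empty word, so changing a cell becomes changing a factor of a
  concatenation.\<close>

definition cell :: "'b tape_symbol \<Rightarrow> 'b tape_symbol list" where
  "cell s = (if s = Blank then [] else [s])"

lemma cell_simps [simp]: "cell Blank = []" "cell (Input x) = [Input x]" "cell (Aux n) = [Aux n]"
  by (simp_all add: cell_def)

lemma cell_eq_Nil [simp]: "cell s = [] \<longleftrightarrow> s = Blank"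
  by (simp add: cell_def)

lemma finite_support_fun_upd [simp]: "finite (support (t(i := a))) \<longleftrightarrow> finite (support t)"
proof -
  have "support (t(i := a)) - {i} = support t - {i}"
    by (auto simp: support_def)
  then show ?thesis
    by (metis finite.emptyI finite_insert finite_Diff2)
qed

lemma left_content_cong:
  assumes "\<And>j. j < i \<Longrightarrow> t j = t' j"
  shows "left_content t i = left_content t' i"
proof -
  have "support t \<inter> {..<i} = support t' \<inter> {..<i}"
    using assms by (auto simp: support_def)
  moreover have "map t (sorted_list_of_set (support t' \<inter> {..<i})) =
      map t' (sorted_list_of_set (support t' \<inter> {..<i}))"
    using assms by (cases "finite (support t' \<inter> {..<i})") auto
  ultimately show ?thesis
    by (simp add: left_content_def)
qed

lemma right_content_cong:
  assumes "\<And>j. j \<ge> i \<Longrightarrow> t j = t' j"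
  shows "right_content t i = right_content t' i"
proof -
  have "support t \<inter> {i..} = support t' \<inter> {i..}"
    using assms by (auto simp: support_def)
  moreover have "map t (sorted_list_of_set (support t' \<inter> {i..})) =
      map t' (sorted_list_of_set (support t' \<inter> {i..}))"
    using assms by (cases "finite (support t' \<inter> {i..})") auto
  ultimately show ?thesis
    by (simp add: right_content_def)
qed

text \<open>A strictly increasing list is determined by its set, and a nonblank cell
  \<open>i\<close> is the new largest position of the left part.\<close>

lemma left_content_Suc:
  assumes "finite (support t)"
  shows "left_content t (i + 1) = left_content t i @ cell (t i)"
proof (cases "t i = Blank")
  case True
  then have "support t \<inter> {..<i + 1} = support t \<inter> {..<i}"
    by (auto simp: support_def) (metis order_le_less zless_add1_eq)
  then show ?thesis
    using True by (simp add: left_content_def)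
next
  case False
  have "sorted_list_of_set (support t \<inter> {..<i + 1}) = sorted_list_of_set (support t \<inter> {..<i}) @ [i]"
    by (rule strict_sorted_equal)
       (use assms False in \<open>auto simp: sorted_wrt_append support_def\<close>)
  then show ?thesis
    using False by (simp add: left_content_def cell_def)
qed

lemma right_content_Suc:
  assumes "finite (support t)"
  shows "right_content t i = cell (t i) @ right_content t (i + 1)"
proof (cases "t i = Blank")
  case True
  then have "support t \<inter> {i..} = support t \<inter> {i + 1..}"
    by (auto simp: support_def) (metis order_le_less zless_imp_add1_zle)
  then show ?thesis
    using True by (simp add: right_content_def)
next
  case False
  have "i # sorted_list_of_set (support t \<inter> {i + 1..}) = sorted_list_of_set (support t \<inter> {i..})"
    by (rule strict_sorted_equal)
       (use assms False in \<open>auto simp: support_def\<close>)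
  then show ?thesis
    using False by (simp add: right_content_def cell_def flip: list.map)
qed

lemma right_content_eq_Nil:
  assumes "finite (support t)"
  shows "right_content t i = [] \<longleftrightarrow> (\<forall>j\<ge>i. t j = Blank)"
  using assms by (auto simp: right_content_def support_def)

text \<open>The contents \<open>l\<close> and \<open>r\<close> beyond the two touched cells are
  shared by both tapes. Only the two factors in between change, and the first of them passes to the
  left of the head.\<close>

lemma content_Move_Right:
  assumes "finite (support t)" "t i = a" "t (i + 1) = b" "t' = t(i := c, i + 1 := d)"
  obtains l r where "left_content t i = l" "right_content t i = cell a @ cell b @ r"
    "left_content t' (i + 1) = l @ cell c" "right_content t' (i + 1) = cell d @ r"
proof
  have "finite (support t')"
    using assms by simp
  note suc = left_content_Suc[OF this, of i] right_content_Suc[OF this, of "i + 1"]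
  show "left_content t i = left_content t i" ..
  show "right_content t i = cell a @ cell b @ right_content t (i + 2)"
    using right_content_Suc[OF assms(1), of i] right_content_Suc[OF assms(1), of "i + 1"] assms
    by (simp add: add.commute)
  have "left_content t' i = left_content t i"
    using assms(4) by (intro left_content_cong) auto
  then show "left_content t' (i + 1) = left_content t i @ cell c"
    using suc(1) assms(4) by simp
  have "right_content t' (i + 2) = right_content t (i + 2)"
    using assms(4) by (intro right_content_cong) auto
  then show "right_content t' (i + 1) = cell d @ right_content t (i + 2)"
    using suc(2) assms(4) by (simp add: add.commute)
qed

lemma content_Stay:
  assumes "finite (support t)" "t i = a" "t' = t(i := b)"
  obtains r where "right_content t i = cell a @ r" "right_content t' i = cell b @ r"
    "left_content t' i = left_content t i"
proof
  have *: "finite (support t')"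
    using assms by simp
  show "right_content t i = cell a @ right_content t (i + 1)"
    using right_content_Suc[OF assms(1), of i] assms by simp
  have "right_content t' (i + 1) = right_content t (i + 1)"
    using assms(3) by (intro right_content_cong) auto
  then show "right_content t' i = cell b @ right_content t (i + 1)"
    using right_content_Suc[OF *, of i] assms(3) by simp
  show "left_content t' i = left_content t i"
    using assms(3) by (intro left_content_cong) auto
qed


text \<open>The nonblank cells from \<open>i\<close> on have no gaps. This ensures that the first
  blank met by the scan is the end of the input, so that the right marker does not land inside
  it.\<close>

definition blank_after :: "(int \<Rightarrow> 'b tape_symbol) \<Rightarrow> int \<Rightarrow> bool" where
  "blank_after t i \<longleftrightarrow> (\<forall>j\<ge>i. t j = Blank \<longrightarrow> right_content t j = [])"

lemma blank_after_Suc: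
  assumes "t i \<noteq> Blank"
  shows "blank_after t i \<longleftrightarrow> blank_after t (i + 1)"
proof -
  have "j \<ge> i \<and> t j = Blank \<longleftrightarrow> j \<ge> i + 1 \<and> t j = Blank" for j
    using assms by (cases "j = i") auto
  then show ?thesis
    by (auto simp: blank_after_def)
qed

lemma blank_after_cong:
  assumes "\<And>j. j \<ge> i \<Longrightarrow> t j = t' j"
  shows "blank_after t i \<longleftrightarrow> blank_after t' i"
proof -
  have "right_content t j = right_content t' j" if "j \<ge> i" for j
    using that assms by (intro right_content_cong) auto
  then show ?thesis
    using assms by (simp add: blank_after_def)
qed

lemma blank_after_if_right_content_Nil:
  assumes "finite (support t)" "right_content t i = []"
  shows "blank_after t i"
  using assms by (auto simp: blank_after_def right_content_eq_Nil)


section \<open>The machine of a set of relators\<close>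

abbreviation left_marker :: "'b tape_symbol" where "left_marker \<equiv> Aux 0"
abbreviation right_marker :: "'b tape_symbol" where "right_marker \<equiv> Aux (Suc 0)"

text \<open>\<open>Q\<close> stays abstract here. It will be the set of relators together with all
  words \<open>a a^-1\<close>, so that free reduction and relators are handled by the same
  moves.\<close>

locale relator_machine =
  fixes A :: "'a set" and Q :: "'a letter list set"
  assumes finite_A: "finite A" and finite_Q: "finite Q"
    and Q_words: "Q \<subseteq> lists (letters A)" and Nil_notin_Q: "[] \<notin> Q"
begin

text \<open>The suffixes of the words of \<open>Q\<close>, that is, what can remain to be written.
  There are finitely many, so the state can store one. The word \<open>[]\<close> is added for the
  case of empty \<open>Q\<close>.\<close>

definition pending :: "'a letter list set" where
  "pending = insert [] (\<Union>q\<in>Q. (\<lambda>n. drop n q) ` {..length q})"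

text \<open>An injective numbering of \<open>pending\<close>, shifted by 3 to avoid the states 0, 1
  and 2.\<close>

definition pending_state :: "'a letter list \<Rightarrow> nat" where
  "pending_state s = to_nat_on pending s + 3"

text \<open>The symbols that may stand between the two end markers.\<close>

definition inner :: "'a letter tape_symbol set" where
  "inner = insert Blank (Input ` letters A)"

text \<open>State 0 is initial, state 1 places the right marker and state 2 accepts. In
  \<^term>\<open>pending_state s\<close> the word \<open>s\<close> is still to be written at the head, so it counts as part
  of the tape contents.\<close>

inductive_set moves :: "'a letter transition set" where
  unmark_left: "b \<in> inner \<Longrightarrow> (1, Move_Right left_marker b Blank b, 0) \<in> moves"
| scan: "a \<in> insert left_marker (Input ` letters A) \<Longrightarrow> b \<in> inner \<Longrightarrow>
    (1, Move_Right a b a b, 1) \<in> moves"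
| mark_right: "(1, Stay Blank right_marker, pending_state []) \<in> moves"
| walk: "a \<in> insert left_marker inner \<Longrightarrow> b \<in> insert right_marker inner \<Longrightarrow>
    (pending_state [], Move_Right a b a b, pending_state []) \<in> moves"
| swap: "a \<in> insert right_marker (Input ` letters A) \<Longrightarrow>
    (pending_state [], Move_Right a Blank Blank a, pending_state []) \<in> moves"
| relator: "q \<in> Q \<Longrightarrow> (pending_state q, Stay Blank Blank, pending_state []) \<in> moves"
| emit: "x # s \<in> pending \<Longrightarrow> b \<in> insert right_marker inner \<Longrightarrow>
    (pending_state (x # s), Move_Right Blank b (Input x) b, pending_state s) \<in> moves"
| accept: "(pending_state [], Move_Right left_marker right_marker left_marker right_marker, 2) \<in> moves"

definition machine :: "'a letter turing_machine" where
  "machine = \<lparr>input_alphabet = letters A,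
     transitions = moves \<union> {(q, reverse_action act, p) | p act q. (p, act, q) \<in> moves},
     initial_state = 0, final_states = {2}\<rparr>"

lemma finite_letters: "finite (letters A)"
  using finite_A by (simp add: letters_def)

lemma finite_pending: "finite pending"
  using finite_Q by (simp add: pending_def)

lemma Nil_in_pending [simp]: "[] \<in> pending"
  by (simp add: pending_def)

lemma Q_in_pending: "q \<in> Q \<Longrightarrow> q \<in> pending"
  by (force simp: pending_def)

lemma pending_tl:
  assumes "x # s \<in> pending"
  shows "s \<in> pending"
proof -
  obtain q n where q: "q \<in> Q" "x # s = drop n q"
    using assms by (auto simp: pending_def)
  then have "n < length q"
    by (metis drop_eq_Nil2 leI list.distinct(1))
  moreover have "s = drop (Suc n) q"
    using q(2) by (metis drop_Suc list.sel(3) tl_drop)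
  ultimately show ?thesis
    using q(1) by (force simp: pending_def)
qed

lemma pending_words: "pending \<subseteq> lists (letters A)"
  using Q_words by (fastforce simp: pending_def in_lists_conv_set dest: in_set_dropD)

lemma pending_state_eq_iff:
  "s \<in> pending \<Longrightarrow> s' \<in> pending \<Longrightarrow> pending_state s = pending_state s' \<longleftrightarrow> s = s'"
  using inj_on_to_nat_on[OF countable_finite[OF finite_pending]]
  by (auto simp: pending_state_def inj_on_def)

lemma pending_state_neq [simp]:
  "pending_state s \<noteq> 0" "pending_state s \<noteq> Suc 0" "pending_state s \<noteq> 2"
  "0 \<noteq> pending_state s" "Suc 0 \<noteq> pending_state s" "2 \<noteq> pending_state s"
  by (simp_all add: pending_state_def)

lemma finite_moves: "finite moves"
proof (rule finite_subset)
  let ?P = "{0, 1, 2} \<union> pending_state ` pending"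
  let ?X = "{left_marker, right_marker} \<union> inner"
  have "p \<in> ?P \<and> set_tape_action act \<subseteq> ?X \<and> q \<in> ?P" if "(p, act, q) \<in> moves" for p act q
    using that by cases (use pending_tl Q_in_pending pending_words in \<open>auto simp: inner_def\<close>)
  then show "moves \<subseteq> ?P \<times> {act. set_tape_action act \<subseteq> ?X} \<times> ?P"
    by auto
  show "finite (?P \<times> {act. set_tape_action act \<subseteq> ?X} \<times> ?P)"
    using finite_pending finite_letters
    by (intro finite_cartesian_product finite_tape_actions) (auto simp: inner_def)
qed

lemma transitions_machine:
  "(p, act, q) \<in> transitions machine \<longleftrightarrow>
    (p, act, q) \<in> moves \<or> (q, reverse_action act, p) \<in> moves"
  by (simp add: machine_def) (metis reverse_action_reverse_action)

lemma symmetric_machine: "symmetric_turing_machine machine"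
proof -
  have "transitions machine = moves \<union> (\<lambda>(p, act, q). (q, reverse_action act, p)) ` moves"
    by (simp add: machine_def) force
  then have "finite (transitions machine)"
    using finite_moves by simp
  then have "turing_machine machine"
    using finite_letters by (simp add: turing_machine_def machine_def)
  then show ?thesis
    by (auto simp: symmetric_turing_machine_def transitions_machine)
qed

text \<open>Reduces every argument about steps to the one-directional set \<open>moves\<close>, each
  element of which is read forwards or backwards.\<close>

lemma tm_step_machine_cases:
  assumes "((p, i, t), (q, j, t')) \<in> tm_step machine"
  obtains act where "(p, act, q) \<in> moves" "acts act i t j t'"
  | act where "(q, act, p) \<in> moves" "acts act j t' i t"
  using assms by (auto simp: tm_step_def transitions_machine acts_reverse_action[of _ j t' i t, symmetric])

end


section \<open>Soundness\<close>

text \<open>\<open>E\<close> will be the word problem. Closure under inserting and deleting words of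
  \<open>Q\<close> is the property of it that soundness rests on.\<close>

locale sound_relator_machine = relator_machine +
  fixes E :: "'a letter list set"
  assumes Nil_in_E: "[] \<in> E"
    and relator_E: "q \<in> Q \<Longrightarrow> u \<in> lists (letters A) \<Longrightarrow> v \<in> lists (letters A) \<Longrightarrow>
      u @ q @ v \<in> E \<longleftrightarrow> u @ v \<in> E"
begin

definition equi :: "'a letter list \<Rightarrow> 'a letter list \<Rightarrow> bool" where
  "equi w y \<longleftrightarrow> y \<in> lists (letters A) \<and> (y \<in> E \<longleftrightarrow> w \<in> E)"

text \<open>The first two conditions keep the head between the markers, both included. This puts the
  pending word \<open>s\<close>, inserted at the head, in the correct place of the tape
  word.\<close>

definition pending_invariant ::
  "'a letter list \<Rightarrow> 'a letter list \<Rightarrow> int \<Rightarrow> (int \<Rightarrow> 'a letter tape_symbol) \<Rightarrow> bool"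
where
  "pending_invariant w s i t \<longleftrightarrow>
     (left_content t i \<noteq> [] \<or> t i = left_marker) \<and> right_content t i \<noteq> [] \<and>
     (\<exists>y. equi w y \<and>
        left_content t i @ map Input s @ right_content t i = left_marker # map Input y @ [right_marker])"

text \<open>The markers appear one by one: none in state 0, the left one in state 1, both later.
  State 2 prescribes the tape as well, because the accepting move can also be undone and must then
  lead back to a valid configuration.\<close>

definition invariant :: "'a letter list \<Rightarrow> 'a letter config \<Rightarrow> bool" where
  "invariant w = (\<lambda>(q, i, t). finite (support t) \<and>
     (q = 0 \<longrightarrow> left_content t i = [] \<and> blank_after t i \<and>
        (\<exists>y. equi w y \<and> right_content t i = map Input y)) \<and>
     (q = 1 \<longrightarrow> blank_after t i \<and>
        (\<exists>y. equi w y \<and> left_content t i @ right_content t i = left_marker # map Input y)) \<and>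
     (q = 2 \<longrightarrow> w \<in> E \<and> left_content t i = [left_marker] \<and> right_content t i = [right_marker]) \<and>
     (\<forall>s\<in>pending. q = pending_state s \<longrightarrow> pending_invariant w s i t))"

lemma invariant_simps:
  assumes "finite (support t)"
  shows "invariant w (0, i, t) \<longleftrightarrow> left_content t i = [] \<and> blank_after t i \<and>
      (\<exists>y. equi w y \<and> right_content t i = map Input y)"
    and "invariant w (Suc 0, i, t) \<longleftrightarrow> blank_after t i \<and>
      (\<exists>y. equi w y \<and> left_content t i @ right_content t i = left_marker # map Input y)"
    and "invariant w (2, i, t) \<longleftrightarrow>
      w \<in> E \<and> left_content t i = [left_marker] \<and> right_content t i = [right_marker]"
    and "s \<in> pending \<Longrightarrow> invariant w (pending_state s, i, t) \<longleftrightarrow> pending_invariant w s i t"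
  using assms by (auto simp: invariant_def pending_state_eq_iff)

text \<open>The marker is not an input letter, so it occurs only once on the right-hand side and the
  split at it is unique.\<close>

lemma left_marker_position:
  "l @ left_marker # r = left_marker # map Input y @ zs \<longleftrightarrow> l = [] \<and> r = map Input y @ zs"
  if "left_marker \<notin> set zs"
proof -
  have "left_marker \<notin> set (map Input y @ zs)"
    using that by auto
  then show ?thesis
    using append_Cons_eq_iff[of left_marker "[]" "map Input y @ zs" l r] by auto
qed

lemma right_marker_position:
  "l @ right_marker # r = left_marker # map Input y @ [right_marker] \<longleftrightarrow>
    l = left_marker # map Input y \<and> r = []"
  using append_Cons_eq_iff[of right_marker "left_marker # map Input y" "[]" l r] by (auto simp: image_iff)

text \<open>As \<open>l\<close> and \<open>r\<close> are nonempty, they absorb the two end markers.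
  Hence \<open>q\<close> lies strictly inside, the word between the markers is
  \<open>u @ q @ v\<close>, and \<open>relator_E\<close> applies.\<close>

lemma invariant_relator:
  assumes "q \<in> Q"
  shows "l \<noteq> [] \<and> r \<noteq> [] \<and>
      (\<exists>y. equi w y \<and> l @ map Input q @ r = left_marker # map Input y @ [right_marker]) \<longleftrightarrow>
    l \<noteq> [] \<and> r \<noteq> [] \<and> (\<exists>y. equi w y \<and> l @ r = left_marker # map Input y @ [right_marker])"
    (is "?lhs \<longleftrightarrow> ?rhs")
proof
  assume ?lhs
  then obtain y l' r' where y: "equi w y" "l' @ map Input q @ r' = map Input y"
    and lr: "l = left_marker # l'" "r = r' @ [right_marker]"
    by (cases l; cases r rule: rev_cases) auto
  then obtain u v v' where uv: "l' = map Input u" "y = u @ v" "map Input q @ r' = map Input v"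
    by (auto simp: append_eq_map_conv)
  then obtain q' v' where "v = q' @ v'" "map Input q' = map (Input :: _ \<Rightarrow> 'a letter tape_symbol) q"
      "r' = map Input v'"
    by (auto simp: append_eq_map_conv)
  then have "v = q @ v'"
    by (simp add: inj_map_eq_map inj_def)
  then have "equi w (u @ v')"
    using y(1) uv(2) relator_E[OF assms, of u v'] by (auto simp: equi_def)
  then show ?rhs
    using lr uv(1) \<open>r' = map Input v'\<close> by (auto intro!: exI[of _ "u @ v'"])
next
  assume ?rhs
  then obtain y l' r' where y: "equi w y" "l' @ r' = map Input y"
    and lr: "l = left_marker # l'" "r = r' @ [right_marker]"
    by (cases l; cases r rule: rev_cases) auto
  then obtain u v where uv: "l' = map Input u" "y = u @ v" "r' = map Input v"
    by (auto simp: append_eq_map_conv)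
  then have "equi w (u @ q @ v)"
    using y(1) assms Q_words relator_E[OF assms, of u v] by (auto simp: equi_def)
  then show ?lhs
    using lr uv by (auto intro!: exI[of _ "u @ q @ v"])
qed

text \<open>The equivalence, rather than an implication, covers the reversed moves of the symmetric
  machine at the same time.\<close>

lemma invariant_move:
  assumes move: "(p, act, q) \<in> moves" and acts: "acts act i t j t'" and fin: "finite (support t)"
  shows "invariant w (p, i, t) \<longleftrightarrow> invariant w (q, j, t')"
  using move
proof cases
  case (unmark_left b)
  then have step: "t i = left_marker" "t (i + 1) = b" "j = i + 1" "t' = t(i := Blank, i + 1 := b)"
    using acts by auto
  then have fin': "finite (support t')"
    using fin by simp
  have "blank_after t' (i + 1) \<longleftrightarrow> blank_after t (i + 1)"
    using step by (intro blank_after_cong) auto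
  then have blank: "blank_after t' (i + 1) \<longleftrightarrow> blank_after t i"
    using step by (simp add: blank_after_Suc)
  from content_Move_Right[OF fin step(1,2,4)] obtain l r where lr:
    "left_content t i = l" "right_content t i = cell left_marker @ cell b @ r"
    "left_content t' (i + 1) = l @ cell Blank" "right_content t' (i + 1) = cell b @ r" .
  show ?thesis
    using unmark_left(1-3) step(1-3) lr blank left_marker_position[of "[]" l "cell b @ r"]
    by (auto simp: invariant_simps[OF fin] invariant_simps[OF fin'])
next
  case (scan a b)
  then have step: "t i = a" "t (i + 1) = b" "j = i + 1" "t' = t"
    using acts by auto
  have "a \<noteq> Blank"
    using scan by auto
  then have "blank_after t i \<longleftrightarrow> blank_after t (i + 1)"
    using step by (simp add: blank_after_Suc)
  then show ?thesis
    using scan step left_content_Suc[OF fin, of i] right_content_Suc[OF fin, of i]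
    by (simp add: invariant_simps[OF fin])
next
  case mark_right
  then have step: "t i = Blank" "j = i" "t' = t(i := right_marker)"
    using acts by auto
  then have fin': "finite (support t')"
    using fin by simp
  from content_Stay[OF fin step(1,3)] obtain r where lr:
    "right_content t i = cell Blank @ r" "right_content t' i = cell right_marker @ r"
    "left_content t' i = left_content t i" .
  \<comment> \<open>The scanned cell is blank, so the absence of gaps means precisely that the word
    ends here and the marker closes it.\<close>
  have "blank_after t i \<longleftrightarrow> r = []"
    using step lr blank_after_if_right_content_Nil[OF fin, of i] by (auto simp: blank_after_def)
  then show ?thesis
    using mark_right step(1,2) lr
    by (auto simp: invariant_simps[OF fin] invariant_simps[OF fin'] pending_invariant_def
        right_marker_position)
next
  case (walk a b)
  then have step: "t i = a" "t (i + 1) = b" "j = i + 1" "t' = t"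
    using acts by auto
  have ab: "a \<noteq> right_marker" "b \<noteq> left_marker"
    using walk by (auto simp: inner_def)
  obtain l r where lr: "left_content t i = l" "right_content t (i + 1) = r" 
    "left_content t (i + 1) = l @ cell a" "right_content t i = cell a @ r"
    using left_content_Suc[OF fin, of i] right_content_Suc[OF fin, of i] step by simp
  \<comment> \<open>The head cannot leave the marked region: a nonblank first symbol is the left
    marker, and a nonblank last symbol is the right marker, which differs from
    \<open>a\<close>.\<close>
  have "l \<noteq> [] \<or> a = left_marker \<longleftrightarrow> l @ cell a \<noteq> []" "cell a @ r \<noteq> [] \<longleftrightarrow> r \<noteq> []"
    if "l @ cell a @ r = left_marker # map Input y @ [right_marker]" for y
  proof -
    show "l \<noteq> [] \<or> a = left_marker \<longleftrightarrow> l @ cell a \<noteq> []"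
      using that by (auto simp: cell_def split: if_splits)
    show "cell a @ r \<noteq> [] \<longleftrightarrow> r \<noteq> []"
      using that ab by (cases r) (auto simp: cell_def split: if_splits)
  qed
  then show ?thesis
    using walk step lr ab
    by (auto simp: invariant_simps[OF fin] pending_invariant_def)
next
  case (swap a)
  then have step: "t i = a" "t (i + 1) = Blank" "j = i + 1" "t' = t(i := Blank, i + 1 := a)"
    using acts by auto
  then have fin': "finite (support t')" and "t' (i + 1) = a"
    using fin by simp_all
  have a: "a \<noteq> left_marker" "a \<noteq> Blank"
    using swap by auto
  from content_Move_Right[OF fin step(1,2,4)] obtain l r where
    "left_content t i = l" "right_content t i = cell a @ cell Blank @ r"
    "left_content t' (i + 1) = l @ cell Blank" "right_content t' (i + 1) = cell a @ r" .
  then show ?thesis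
    using swap(1-3) step(1-3) a \<open>t' (i + 1) = a\<close>
    by (simp add: invariant_simps[OF fin] invariant_simps[OF fin'] pending_invariant_def)
next
  case (relator q)
  then have step: "t i = Blank" "j = i" "t' = t"
    using acts by auto
  show ?thesis
    using relator step invariant_relator[of q "left_content t i" "right_content t i" w] Q_in_pending
    by (simp add: invariant_simps[OF fin] pending_invariant_def)
next
  case (emit x s b)
  then have step: "t i = Blank" "t (i + 1) = b" "j = i + 1" "t' = t(i := Input x, i + 1 := b)"
    using acts by auto
  then have fin': "finite (support t')"
    using fin by simp
  have b: "b \<noteq> left_marker"
    using emit by (auto simp: inner_def)
  \<comment> \<open>The letter \<open>x\<close> leaves the pending word and enters the tape just
    left of the head, so the combined word is unchanged.\<close>
  from content_Move_Right[OF fin step(1,2,4)] obtain l r where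
    "left_content t i = l" "right_content t i = cell Blank @ cell b @ r"
    "left_content t' (i + 1) = l @ cell (Input x)" "right_content t' (i + 1) = cell b @ r" .
  then show ?thesis
    using emit step(1-3) pending_tl[of x s]
    by (cases l) (auto simp: invariant_simps[OF fin] invariant_simps[OF fin'] pending_invariant_def)
next
  case accept
  then have step: "t i = left_marker" "t (i + 1) = right_marker" "j = i + 1" "t' = t"
    "t' = t(i := left_marker, i + 1 := right_marker)"
    using acts by auto
  from content_Move_Right[OF fin step(1,2,5)] step(4) obtain l r where lr:
    "left_content t i = l" "right_content t i = [left_marker, right_marker] @ r"
    "left_content t (i + 1) = l @ [left_marker]" "right_content t (i + 1) = right_marker # r"
    by auto
  \<comment> \<open>Adjacent markers enclose the empty word, for which \<open>equi\<close> says that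
    \<open>w\<close> lies in \<open>E\<close>.\<close>
  have "l @ left_marker # right_marker # r = left_marker # map Input y @ [right_marker] \<longleftrightarrow>
      l = [] \<and> r = [] \<and> y = []" for y :: "'a letter list"
    using left_marker_position[of "[right_marker]" l "right_marker # r" y] by (cases y) auto
  moreover have "equi w [] \<longleftrightarrow> w \<in> E"
    using Nil_in_E by (simp add: equi_def)
  ultimately show ?thesis
    using accept step(1-4) lr by (auto simp: invariant_simps[OF fin] pending_invariant_def)
qed

lemma finite_support_acts:
  assumes "acts act i t j t'"
  shows "finite (support t') \<longleftrightarrow> finite (support t)"
  using assms by (cases act) auto

lemma invariant_step:
  assumes "(c, c') \<in> tm_step machine" "invariant w c"
  shows "invariant w c'"
proof -
  obtain p i t q j t' where c: "c = (p, i, t)" "c' = (q, j, t')"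
    by (cases c; cases c') auto
  have "finite (support t)"
    using assms(2) c by (simp add: invariant_def)
  with assms(1) show ?thesis
    unfolding c
  proof (cases rule: tm_step_machine_cases)
    case (1 act)
    then show "invariant w (q, j, t')"
      using invariant_move \<open>finite (support t)\<close> assms(2) c by blast
  next
    \<comment> \<open>A reversed move: the equivalence is used from right to left.\<close>
    case (2 act)
    then show "invariant w (q, j, t')"
      using invariant_move finite_support_acts \<open>finite (support t)\<close> assms(2) c by blast
  qed
qed

lemma invariant_initial_config:
  assumes "w \<in> lists (letters A)"
  shows "invariant w (initial_config machine w)"
proof -
  define t :: "int \<Rightarrow> 'a letter tape_symbol" where
    "t = (\<lambda>i. if 0 \<le> i \<and> i < int (length w) then Input (w ! nat i) else Blank)"
  have support: "support t = {0..<int (length w)}"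
    by (auto simp: t_def support_def)
  then have fin: "finite (support t)"
    by simp
  have right: "right_content t (int k) = map Input (drop k w)" if "k \<le> length w" for k
    using that
  proof (induction rule: inc_induct)
    case base
    show ?case
      using right_content_eq_Nil[OF fin] by (simp add: t_def)
  next
    case (step k)
    then show ?case
      using right_content_Suc[OF fin, of "int k"]
      by (simp add: t_def add.commute Cons_nth_drop_Suc[symmetric])
  qed
  have "support t \<inter> {..<0} = {}"
    using support by auto
  then have "left_content t 0 = []"
    by (simp add: left_content_def)
  moreover have "right_content t 0 = map Input w"
    using right[of 0] by simp
  moreover have "blank_after t 0"
    using right_content_eq_Nil[OF fin] by (auto simp: blank_after_def t_def split: if_splits)
  ultimately have "invariant w (0, 0, t)"
    using assms by (auto simp: invariant_simps[OF fin] equi_def)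
  then show ?thesis
    by (simp add: initial_config_def machine_def t_def)
qed

lemma accepts_machine_imp:
  assumes "accepts machine w" "w \<in> lists (letters A)"
  shows "w \<in> E"
proof -
  obtain c where c: "c \<in> final_configs machine" "(initial_config machine w, c) \<in> (tm_step machine)\<^sup>*"
    using assms(1) by (auto simp: accepts_def)
  from c(2) have "invariant w c"
    by induction (use invariant_initial_config[OF assms(2)] invariant_step in blast)+
  then show ?thesis
    using c(1) by (cases c) (auto simp: invariant_def final_configs_def machine_def)
qed

end

section \<open>Completeness within a space bound\<close>

lemma accepts_in_space_imp_accepts:
  assumes "accepts_in_space M w s"
  shows "accepts M w"
proof -
  obtain C c where "c \<in> final_configs M"
    and "(initial_config M w, c) \<in> {(c1, c2) \<in> tm_step M. head c1 \<in> C \<and> head c2 \<in> C}\<^sup>*"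
    using assms unfolding accepts_in_space_def by blast
  moreover have "{(c1, c2) \<in> tm_step M. head c1 \<in> C \<and> head c2 \<in> C}\<^sup>* \<subseteq> (tm_step M)\<^sup>*"
    by (rule rtrancl_mono) auto
  ultimately show ?thesis
    unfolding accepts_def by blast
qed

text \<open>The list starts at cell \<open>-1\<close>, the future place of the left marker, so that
  the input stays in its initial cells \<open>0, 1, ...\<close>.\<close>

definition tape :: "'b tape_symbol list \<Rightarrow> int \<Rightarrow> 'b tape_symbol" where
  "tape z i = (if -1 \<le> i \<and> i + 1 < int (length z) then z ! nat (i + 1) else Blank)"

lemma tape_append_Cons [simp]: "tape (x @ a # y) (int (length x) - 1) = a"
  by (simp add: tape_def)

lemma tape_fun_upd [simp]: "(tape (x @ a # y))(int (length x) - 1 := b) = tape (x @ b # y)"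
proof
  fix i
  have "(x @ a # y) ! nat (i + 1) = (x @ b # y) ! nat (i + 1)"
    if "-1 \<le> i" "i \<noteq> int (length x) - 1"
  proof -
    have "nat (i + 1) \<noteq> length x"
      using that by auto
    then show ?thesis
      by (auto simp: nth_append nth_Cons')
  qed
  then show "((tape (x @ a # y))(int (length x) - 1 := b)) i = tape (x @ b # y) i"
    by (auto simp: tape_def)
qed

text \<open>The word \<open>x @ y\<close> starts at cell \<open>-1\<close> and the head scans the first letter of \<open>y\<close>.\<close>

definition conf :: "nat \<Rightarrow> 'b tape_symbol list \<Rightarrow> 'b tape_symbol list \<Rightarrow> 'b config" where
  "conf q x y = (q, int (length x) - 1, tape (x @ y))"

section \<open>Runs inside a fixed window of cells\<close>

context relator_machine
begin

text \<open>The window has room for the left marker at \<open>-1\<close>, a word of length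
  \<open>N\<close> and the right marker behind it.\<close>

definition linked :: "nat \<Rightarrow> ('a letter config \<times> 'a letter config) set" where
  "linked N =
     {(c1, c2) \<in> tm_step machine. head c1 \<in> {-1..int N} \<and> head c2 \<in> {-1..int N}}\<^sup>*"

lemma linked_refl [simp]: "(c, c) \<in> linked N"
  by (simp add: linked_def)

text \<open>Symmetry of the machine lets every run be undone in the same window, so each operation
  below also provides its inverse.\<close>

lemma linked_sym: "(c, c') \<in> linked N \<Longrightarrow> (c', c) \<in> linked N"
proof -
  have "sym (linked N)"
    unfolding linked_def
    using sym_tm_step[OF symmetric_machine] by (intro sym_rtrancl) (auto simp: sym_def)
  then show "(c, c') \<in> linked N \<Longrightarrow> (c', c) \<in> linked N"
    by (rule symD)
qed

lemma linked_trans [trans]: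
  "(c, c') \<in> linked N \<Longrightarrow> (c', c'') \<in> linked N \<Longrightarrow> (c, c'') \<in> linked N"
  unfolding linked_def by (rule rtrancl_trans)

lemma linked_move:
  assumes "(p, act, q) \<in> moves" "acts act i t j t'" "i \<in> {-1..int N}" "j \<in> {-1..int N}"
  shows "((p, i, t), (q, j, t')) \<in> linked N"
proof -
  have "((p, i, t), (q, j, t')) \<in> tm_step machine"
    using assms(1,2) by (auto simp: tm_step_def transitions_machine)
  then show ?thesis
    using assms(3,4) unfolding linked_def by (intro r_into_rtrancl) (auto simp: head_def)
qed

lemma linked_Stay:
  assumes "(p, Stay a b, q) \<in> moves" "length x \<le> Suc N"
  shows "(conf p x (a # y), conf q x (b # y)) \<in> linked N"
  unfolding conf_def using assms by (intro linked_move[OF assms(1)]) auto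

lemma linked_Move_Right:
  assumes "(p, Move_Right a b c d, q) \<in> moves" "length x \<le> N"
  shows "(conf p x (a # b # y), conf q (x @ [c]) (d # y)) \<in> linked N"
proof -
  have "tape (x @ a # b # y) (int (length x)) = b"
    using tape_append_Cons[of "x @ [a]" b y] by simp
  moreover have "(tape (x @ c # b # y))(int (length x) := d) = tape (x @ c # d # y)"
    using tape_fun_upd[of "x @ [c]" b y d] by simp
  ultimately show ?thesis
    unfolding conf_def using assms(2) by (intro linked_move[OF assms(1)]) auto
qed

text \<open>Stated for general symbol sets so that it serves both the initial scan, over letters
  only, and the later walks, over letters and blanks.\<close>

lemma linked_pass:
  assumes "\<And>a b. a \<in> insert left_marker X \<Longrightarrow> b \<in> Y \<Longrightarrow> (q, Move_Right a b a b, q) \<in> moves"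
    and "X \<subseteq> Y" "u \<in> lists X" "b \<in> Y" "length u \<le> N"
  shows "(conf q [] (left_marker # u @ b # y), conf q (left_marker # u) (b # y)) \<in> linked N"
  using assms(3-5)
proof (induction u arbitrary: b y rule: rev_induct)
  case Nil
  then show ?case
    using linked_Move_Right[OF assms(1), of left_marker b "[]"] by simp
next
  case (snoc d u)
  then have "(conf q [] (left_marker # u @ d # b # y), conf q (left_marker # u) (d # b # y)) \<in> linked N"
    using assms(2) by auto
  also have "(conf q (left_marker # u) (d # b # y), conf q ((left_marker # u) @ [d]) (b # y)) \<in> linked N"
    using snoc.prems by (intro linked_Move_Right assms(1)) auto
  finally show ?case
    by simp
qed

lemma linked_walk:
  assumes "u \<in> lists inner" "b \<in> insert right_marker inner" "length u \<le> N"
  shows "(conf (pending_state []) [] (left_marker # u @ b # y),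
      conf (pending_state []) (left_marker # u) (b # y)) \<in> linked N"
  by (rule linked_pass[OF moves.walk, of inner "insert right_marker inner"]) (use assms in auto)

text \<open>The resting position, with the head on the left marker. Operations that start and end
  here can be composed freely.\<close>

definition home :: "'a letter tape_symbol list \<Rightarrow> 'a letter config" where
  "home z = conf (pending_state []) [] (left_marker # z)"

text \<open>Walk to the symbol \<open>a\<close>, exchange it with the blank, and return by reversing
  a walk.\<close>

lemma home_swap:
  assumes "u \<in> lists inner" "a \<in> insert right_marker (Input ` letters A)" "length u < N"
  shows "(home (u @ a # Blank # y), home (u @ Blank # a # y)) \<in> linked N"
proof -
  have a: "a \<in> insert right_marker inner"
    using assms(2) by (auto simp: inner_def)
  have "(home (u @ a # Blank # y), conf (pending_state []) (left_marker # u) (a # Blank # y)) \<in> linked N"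
    unfolding home_def using assms a by (intro linked_walk) auto
  also have "(conf (pending_state []) (left_marker # u) (a # Blank # y),
      conf (pending_state []) ((left_marker # u) @ [Blank]) (a # y)) \<in> linked N"
    using assms by (intro linked_Move_Right moves.swap) auto
  also have "(conf (pending_state []) ((left_marker # u) @ [Blank]) (a # y),
      home (u @ Blank # a # y)) \<in> linked N"
    using linked_walk[of "u @ [Blank]" a N y] assms a
    by - (rule linked_sym, auto simp: home_def inner_def)
  finally show ?thesis .
qed

text \<open>The blank travels left through \<open>v\<close>, passing its last letter first; hence
  the induction from the right end.\<close>

lemma home_shift_blank:
  assumes "u \<in> lists inner" "v \<in> lists (Input ` letters A)" "length u + length v \<le> N"
  shows "(home (u @ v @ Blank # y), home (u @ Blank # v @ y)) \<in> linked N"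
  using assms(2,3)
proof (induction v arbitrary: y rule: rev_induct)
  case Nil
  then show ?case by simp
next
  case (snoc a v)
  have "(home ((u @ v) @ a # Blank # y), home ((u @ v) @ Blank # a # y)) \<in> linked N"
    using snoc.prems assms(1) by (intro home_swap) (auto simp: inner_def)
  also have "(home ((u @ v) @ Blank # a # y), home (u @ Blank # v @ a # y)) \<in> linked N"
    using snoc.IH[of "a # y"] snoc.prems by simp
  finally show ?case
    by simp
qed

text \<open>Opens a gap of \<open>k\<close> blanks in front of \<open>v\<close> by fetching blanks
  from behind the right marker one at a time.\<close>

lemma home_shift_blanks:
  assumes "u \<in> lists inner" "v \<in> lists (Input ` letters A)" "length u + length v + k \<le> N"
  shows "(home (u @ v @ right_marker # replicate k Blank @ y),
      home (u @ replicate k Blank @ v @ right_marker # y)) \<in> linked N"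
  using assms(1,3)
proof (induction k arbitrary: u)
  case 0
  then show ?case by simp
next
  case (Suc k)
  have "(home ((u @ v) @ right_marker # Blank # replicate k Blank @ y),
      home ((u @ v) @ Blank # right_marker # replicate k Blank @ y)) \<in> linked N"
    using Suc.prems assms(2) by (intro home_swap) (auto simp: inner_def)
  also have "(home ((u @ v) @ Blank # right_marker # replicate k Blank @ y),
      home (u @ Blank # v @ right_marker # replicate k Blank @ y)) \<in> linked N"
    using home_shift_blank[OF Suc.prems(1) assms(2), of N] Suc.prems by simp
  also have "(home (u @ Blank # v @ right_marker # replicate k Blank @ y),
      home ((u @ [Blank]) @ replicate k Blank @ v @ right_marker # y)) \<in> linked N"
    using Suc.IH[of "u @ [Blank]"] Suc.prems by (simp add: inner_def)
  finally show ?case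
    by simp
qed

lemma linked_emit:
  assumes "s \<in> pending" "b \<in> insert right_marker inner" "length u + length s \<le> N"
  shows "(conf (pending_state s) (left_marker # u) (replicate (length s) Blank @ b # y),
      conf (pending_state []) (left_marker # u @ map Input s) (b # y)) \<in> linked N"
  using assms(1,3)
proof (induction s arbitrary: u)
  case Nil
  then show ?case by simp
next
  case (Cons x s)
  \<comment> \<open>The cell that \<open>emit\<close> inspects next is a blank of the block, or
    \<open>b\<close> once the block is used up.\<close>
  obtain b' y' where b': "replicate (length s) Blank @ b # y = b' # y'" "b' \<in> insert right_marker inner"
    using assms(2) by (cases s) (auto simp: inner_def)
  have "(conf (pending_state (x # s)) (left_marker # u) (Blank # b' # y'),
      conf (pending_state s) ((left_marker # u) @ [Input x]) (b' # y')) \<in> linked N"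
    using Cons.prems b'(2) by (intro linked_Move_Right moves.emit) auto
  also have "(conf (pending_state s) ((left_marker # u) @ [Input x]) (b' # y'),
      conf (pending_state []) (left_marker # u @ map Input (x # s)) (b # y)) \<in> linked N"
    using Cons.IH[of "u @ [Input x]"] Cons.prems pending_tl b'(1) by auto
  finally show ?case
    using b'(1) by simp
qed

lemma home_relator:
  assumes "u \<in> lists inner" "b \<in> insert right_marker inner" "q \<in> Q" "length u + length q \<le> N"
  shows "(home (u @ replicate (length q) Blank @ b # y), home (u @ map Input q @ b # y)) \<in> linked N"
proof -
  \<comment> \<open>Words of \<open>Q\<close> are nonempty, so the head finds a blank in the gap, as
    \<open>relator\<close> requires.\<close>
  obtain k where k: "length q = Suc k"
    using assms(3) Nil_notin_Q by (cases q) auto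
  have "map Input q \<in> lists inner"
    using assms(3) Q_words by (fastforce simp: inner_def)
  then have uq: "u @ map Input q \<in> lists inner"
    using assms(1) by simp
  have "(home (u @ replicate (length q) Blank @ b # y),
      conf (pending_state []) (left_marker # u) (replicate (length q) Blank @ b # y)) \<in> linked N"
    unfolding home_def using assms k by (auto simp: inner_def intro!: linked_walk)
  \<comment> \<open>Here \<open>relator\<close> runs backwards and loads \<open>q\<close> into the
    state.\<close>
  also have "(conf (pending_state []) (left_marker # u) (replicate (length q) Blank @ b # y),
      conf (pending_state q) (left_marker # u) (replicate (length q) Blank @ b # y)) \<in> linked N"
    unfolding k replicate_Suc append_Cons
    using assms by (intro linked_sym[OF linked_Stay] moves.relator) auto
  also have "(conf (pending_state q) (left_marker # u) (replicate (length q) Blank @ b # y),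
      conf (pending_state []) (left_marker # u @ map Input q) (b # y)) \<in> linked N"
    using assms by (intro linked_emit Q_in_pending) auto
  also have "(conf (pending_state []) (left_marker # u @ map Input q) (b # y),
      home (u @ map Input q @ b # y)) \<in> linked N"
    using linked_walk[OF uq assms(2), of N y] assms(4)
    by - (rule linked_sym, simp add: home_def)
  finally show ?thesis .
qed

section \<open>Bounded insertions and deletions carried out by the machine\<close>

text \<open>For words of length at most \<open>N\<close>, the padding fills the same window each
  time; the blanks behind the right marker are the room for insertions.\<close>

definition word_config :: "nat \<Rightarrow> 'a letter list \<Rightarrow> 'a letter config" where
  "word_config N y = home (map Input y @ right_marker # replicate (N - length y) Blank)"

definition insertion :: "nat \<Rightarrow> ('a letter list \<times> 'a letter list) set" where
  "insertion N = {(u @ v, u @ q @ v) | u q v.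
     u \<in> lists (letters A) \<and> v \<in> lists (letters A) \<and> q \<in> Q \<and> length (u @ q @ v) \<le> N}"

definition insertion_eq :: "nat \<Rightarrow> ('a letter list \<times> 'a letter list) set" where
  "insertion_eq N = (insertion N \<union> (insertion N)\<inverse>)\<^sup>*"

lemma insertion_eqI: "(x, y) \<in> insertion N \<Longrightarrow> (x, y) \<in> insertion_eq N"
  by (auto simp: insertion_eq_def)

lemma insertion_eq_refl [simp]: "(x, x) \<in> insertion_eq N"
  by (simp add: insertion_eq_def)

lemma insertion_eq_sym: "(x, y) \<in> insertion_eq N \<Longrightarrow> (y, x) \<in> insertion_eq N"
  unfolding insertion_eq_def
  by (rule symD[OF sym_rtrancl]) (auto simp: sym_def)

lemma insertion_eq_trans [trans]:
  "(x, y) \<in> insertion_eq N \<Longrightarrow> (y, z) \<in> insertion_eq N \<Longrightarrow> (x, z) \<in> insertion_eq N"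
  unfolding insertion_eq_def by (rule rtrancl_trans)

lemma insertion_eq_mono: "N \<le> N' \<Longrightarrow> insertion_eq N \<subseteq> insertion_eq N'"
proof -
  assume "N \<le> N'"
  then have "insertion N \<subseteq> insertion N'"
    unfolding insertion_def using le_trans by blast
  then show "insertion_eq N \<subseteq> insertion_eq N'"
    unfolding insertion_eq_def by (intro rtrancl_mono) blast
qed

text \<open>A gap of \<open>length q\<close> blanks is opened between \<open>u\<close> and
  \<open>v\<close> and then filled with \<open>q\<close>.\<close>

lemma insertion_linked:
  assumes "(x, y) \<in> insertion N"
  shows "(word_config N x, word_config N y) \<in> linked N"
proof -
  obtain u q v where uv: "x = u @ v" "y = u @ q @ v" "u \<in> lists (letters A)" "v \<in> lists (letters A)"
    and q: "q \<in> Q" and N: "length (u @ q @ v) \<le> N"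
    using assms by (auto simp: insertion_def)
  define k where "k = N - length (u @ q @ v)"
  have k: "N - length x = length q + k" "N - length y = k"
    using uv(1,2) N by (auto simp: k_def)
  have u: "map Input u \<in> lists inner" and v: "map Input v \<in> lists (Input ` letters A)"
    using uv by (auto simp: inner_def)
  \<comment> \<open>The symbol just behind the gap: the first letter of \<open>v\<close>, or the
    right marker if \<open>v\<close> is empty.\<close>
  obtain b z where b: "map Input v @ right_marker # replicate k Blank = b # z"
      "b \<in> insert right_marker inner"
    using v by (cases v) (auto simp: inner_def)
  have "(word_config N x, home (map Input u @ replicate (length q) Blank @ b # z)) \<in> linked N"
    unfolding word_config_def k(1)
    using home_shift_blanks[OF u v, of "length q" N "replicate k Blank"] N b(1)
    by (simp add: uv(1) replicate_add)
  also have "(home (map Input u @ replicate (length q) Blank @ b # z),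
      home (map Input u @ map Input q @ b # z)) \<in> linked N"
    using N by (intro home_relator u b(2) q) auto
  also have "home (map Input u @ map Input q @ b # z) = word_config N y"
    unfolding word_config_def k(2) b(1)[symmetric] by (simp add: uv(2))
  finally show ?thesis .
qed

lemma insertion_eq_linked:
  assumes "(x, y) \<in> insertion_eq N"
  shows "(word_config N x, word_config N y) \<in> linked N"
  using assms unfolding insertion_eq_def
proof induction
  case base
  show ?case by simp
next
  case (step y z)
  from step.hyps(2) have "(word_config N y, word_config N z) \<in> linked N"
    using insertion_linked linked_sym by blast
  with step.IH show ?case
    by (rule linked_trans)
qed

lemma initial_config_linked:
  assumes "w \<in> lists (letters A)" "length w \<le> N"
  shows "(initial_config machine w, word_config N w) \<in> linked N"
proof -
  define z where "z = (replicate (N - length w) Blank :: 'a letter tape_symbol list)"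
  have w: "map Input w \<in> lists (Input ` letters A)" and w': "map Input w \<in> lists inner"
    using assms(1) by (auto simp: inner_def)
  obtain b y where b: "map Input w @ Blank # z = b # y" "b \<in> inner"
    using w by (cases w) (auto simp: inner_def)
  have "(if 0 \<le> i \<and> i < int (length w) then Input (w ! nat i) else Blank) =
      tape (Blank # map Input w @ Blank # z) i" for i
    by (auto simp: tape_def z_def nth_Cons' nth_append nat_add_distrib)
  then have "initial_config machine w = conf 0 ([] @ [Blank]) (b # y)"
    unfolding b(1)[symmetric] by (simp add: initial_config_def machine_def conf_def)
  \<comment> \<open>\<open>unmark_left\<close> is run backwards: the head goes from cell
    \<open>0\<close> to the blank cell \<open>-1\<close> and writes the left marker there.\<close>
  also have "(conf 0 ([] @ [Blank]) (b # y), conf 1 [] (left_marker # b # y)) \<in> linked N"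
    by (rule linked_sym, intro linked_Move_Right moves.unmark_left b(2)) auto
  also have "conf 1 [] (left_marker # b # y) = conf 1 [] (left_marker # map Input w @ Blank # z)"
    using b(1) by simp
  also have "(conf 1 [] (left_marker # map Input w @ Blank # z),
      conf 1 (left_marker # map Input w) (Blank # z)) \<in> linked N"
    using w assms(2) by (intro linked_pass[OF moves.scan, of _ inner]) (auto simp: inner_def)
  also have "(conf 1 (left_marker # map Input w) (Blank # z),
      conf (pending_state []) (left_marker # map Input w) (right_marker # z)) \<in> linked N"
    using assms(2) by (intro linked_Stay moves.mark_right) auto
  also have "(conf (pending_state []) (left_marker # map Input w) (right_marker # z),
      word_config N w) \<in> linked N"
    unfolding word_config_def home_def z_def
    using w' assms(2) by (intro linked_sym[OF linked_walk]) auto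
  finally show ?thesis .
qed

lemma accepts_in_space_machine:
  assumes "w \<in> lists (letters A)" "length w \<le> N" "(w, []) \<in> insertion_eq N"
  shows "accepts_in_space machine w (N + 2)"
proof -
  define z where "z = (replicate N Blank :: 'a letter tape_symbol list)"
  have "(initial_config machine w, word_config N w) \<in> linked N"
    by (rule initial_config_linked[OF assms(1,2)])
  also have "(word_config N w, word_config N []) \<in> linked N"
    by (rule insertion_eq_linked[OF assms(3)])
  also have "word_config N [] = conf (pending_state []) [] (left_marker # right_marker # z)"
    by (simp add: word_config_def home_def z_def)
  also have "(conf (pending_state []) [] (left_marker # right_marker # z),
      conf 2 ([] @ [left_marker]) (right_marker # z)) \<in> linked N"
    by (intro linked_Move_Right moves.accept) auto
  finally have "(initial_config machine w, conf 2 ([] @ [left_marker]) (right_marker # z)) \<in> linked N" .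
  moreover have "conf 2 ([] @ [left_marker]) (right_marker # z) \<in> final_configs machine"
    by (simp add: conf_def final_configs_def machine_def)
  ultimately show ?thesis
    unfolding accepts_in_space_def linked_def
    \<comment> \<open>The window consists of exactly \<open>N + 2\<close> cells.\<close>
    by (intro exI[of _ "{-1..int N}"]) auto
qed

end

section \<open>Words and presentations\<close>

lemma length_inv_word [simp]: "length (inv_word w) = length w"
  by (simp add: inv_word_def)

lemma inv_word_append: "inv_word (u @ v) = inv_word v @ inv_word u"
  by (simp add: inv_word_def)

lemma inv_word_inv_word [simp]: "inv_word (inv_word w) = w"
  by (simp add: inv_word_def rev_map comp_def)

definition trivial_relators :: "'a set \<Rightarrow> 'a letter list set" where
  "trivial_relators A = {[a, inv_letter a] | a. a \<in> letters A}"

lemma trivial_relator: "a \<in> letters A \<Longrightarrow> [a, inv_letter a] \<in> trivial_relators A"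
  by (auto simp: trivial_relators_def)

text \<open>Inverting \<open>u v^-1 = r^-1\<close> gives \<open>v u^-1 = r\<close>, so a rule from
  an inverse relator is the reverse of a rule from a relator.\<close>

lemma U_R_cases:
  assumes "(u, v) \<in> U_R A R"
  obtains "u @ inv_word v \<in> R" | "v @ inv_word u \<in> R"
proof -
  have "u @ inv_word v \<in> R \<or> (\<exists>r\<in>R. u @ inv_word v = inv_word r)"
    using assms by (auto simp: U_R_def)
  moreover have "v @ inv_word u = r" if "u @ inv_word v = inv_word r" for r
    using arg_cong[OF that, of inv_word] by (simp add: inv_word_append)
  ultimately show ?thesis
    using that by blast
qed

section \<open>Rewriting derivations as bounded insertions and deletions\<close>

context relator_machine
begin

lemma insertionI:
  "u \<in> lists (letters A) \<Longrightarrow> v \<in> lists (letters A) \<Longrightarrow> q \<in> Q \<Longrightarrow> length u + length q + length v \<le> N \<Longrightarrow>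
    (u @ v, u @ q @ v) \<in> insertion_eq N"
  by (rule insertion_eqI) (force simp: insertion_def)

lemma insertion_eq_invariant:
  assumes "(x, y) \<in> insertion_eq N" "P x"
    and "\<And>u q v. u \<in> lists (letters A) \<Longrightarrow> v \<in> lists (letters A) \<Longrightarrow> q \<in> Q \<Longrightarrow>
      P (u @ q @ v) \<longleftrightarrow> P (u @ v)"
  shows "P y"
  using assms(1) unfolding insertion_eq_def
proof induction
  case base
  show ?case by fact
next
  case (step y z)
  then show ?case
    using assms(3) by (auto simp: insertion_def)
qed

text \<open>Inverse pairs are inserted in the middle, one for each letter of \<open>x\<close>,
  beginning with its last letter. The words only grow, so bounding the final one suffices.\<close>

lemma insert_inverse:
  assumes "trivial_relators A \<subseteq> Q" "x \<in> lists (letters A)" "u \<in> lists (letters A)" "v \<in> lists (letters A)"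
    and "length u + 2 * length x + length v \<le> N"
  shows "(u @ v, u @ inv_word x @ x @ v) \<in> insertion_eq N"
  using assms(2,5)
proof (induction x rule: list.induct)
  case Nil
  then show ?case by (simp add: inv_word_def)
next
  case (Cons a x)
  have a: "inv_letter a \<in> letters A" and x: "x \<in> lists (letters A)"
    using Cons.prems by (auto intro: inv_letter_in_letters)
  have "(u @ v, u @ inv_word x @ x @ v) \<in> insertion_eq N"
    using Cons.IH[OF x] Cons.prems by simp
  also have "((u @ inv_word x) @ x @ v, (u @ inv_word x) @ [inv_letter a, a] @ x @ v) \<in> insertion_eq N"
    using trivial_relator[OF a] assms(1,3,4) x inv_word_in_lists[OF x] Cons.prems
    by (intro insertionI) auto
  then have "(u @ inv_word x @ x @ v, u @ inv_word (a # x) @ (a # x) @ v) \<in> insertion_eq N"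
    by (simp add: inv_word_def)
  finally show ?case .
qed

text \<open>The detour through \<open>p u v^-1 v q\<close> adds at most \<open>2 * length v\<close>,
  and \<open>v\<close> is no longer than the relator \<open>u v^-1\<close>.\<close>

lemma replace_insertion_eq:
  assumes "trivial_relators A \<subseteq> Q" "u @ inv_word v \<in> Q" "length (u @ inv_word v) \<le> K"
    and "p \<in> lists (letters A)" "q \<in> lists (letters A)" "u \<in> lists (letters A)" "v \<in> lists (letters A)"
    and "length (p @ u @ q) \<le> F" "length (p @ v @ q) \<le> F"
  shows "(p @ u @ q, p @ v @ q) \<in> insertion_eq (F + 2 * K)"
proof -
  have "((p @ u) @ q, (p @ u) @ inv_word v @ v @ q) \<in> insertion_eq (F + 2 * K)"
    using assms by (intro insert_inverse) auto
  \<comment> \<open>Read backwards, this deletes the relator \<open>u v^-1\<close>.\<close>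
  moreover have "(p @ v @ q, p @ (u @ inv_word v) @ v @ q) \<in> insertion_eq (F + 2 * K)"
    using assms by (intro insertionI) auto
  ultimately show ?thesis
    using insertion_eq_sym insertion_eq_trans by (metis append_assoc)
qed

lemma rewrite_step_insertion_eq:
  assumes "Q = R \<union> trivial_relators A" "\<And>r. r \<in> R \<Longrightarrow> length r \<le> K"
    and "(x, y) \<in> rewrite_step (letters A) (U_R A R \<union> U_FG A)" "length x \<le> F" "length y \<le> F"
  shows "(x, y) \<in> insertion_eq (F + 2 * K)"
proof -
  obtain p q u v where xy: "x = p @ u @ q" "y = p @ v @ q" and p: "p \<in> lists (letters A)"
    and q: "q \<in> lists (letters A)" and uv: "(u, v) \<in> U_R A R \<union> U_FG A"
    using assms(3) unfolding rewrite_step_def by blast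
  from uv show ?thesis
  proof
    assume uv: "(u, v) \<in> U_R A R"
    then have words: "u \<in> lists (letters A)" "v \<in> lists (letters A)"
      by (simp_all add: U_R_def)
    from uv show ?thesis
    proof (cases rule: U_R_cases)
      case 1
      then show ?thesis
        using assms(1,4,5) assms(2)[OF 1] words p q unfolding xy
        by (intro replace_insertion_eq) auto
    next
      \<comment> \<open>The relator belongs to the opposite rule from \<open>v\<close> to
        \<open>u\<close>, whose simulation is reversed.\<close>
      case 2
      then show ?thesis
        using assms(1,4,5) assms(2)[OF 2] words p q unfolding xy
        by (intro insertion_eq_sym[OF replace_insertion_eq]) auto
    qed
  next
    assume "(u, v) \<in> U_FG A"
    then obtain a where a: "a \<in> letters A"
      and "u = [a, inv_letter a] \<and> v = [] \<or> u = [] \<and> v = [a, inv_letter a]"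
      unfolding U_FG_def by blast
    then consider "u = [a, inv_letter a]" "v = []" | "u = []" "v = [a, inv_letter a]"
      by blast
    then show ?thesis
    proof cases
      case 1
      then show ?thesis
        using trivial_relator[OF a] assms p q insertion_eq_sym[OF insertionI[OF p q, of "[a, inv_letter a]" "F + 2 * K"]]
        unfolding xy by auto
    next
      case 2
      then show ?thesis
        using trivial_relator[OF a] assms p q insertionI[OF p q, of "[a, inv_letter a]" "F + 2 * K"]
        unfolding xy by auto
    qed
  qed
qed

lemma pad_insertion_eq:
  assumes "trivial_relators A \<subseteq> Q" "a \<in> letters A" "x \<in> lists (letters A)" "length x + 2 * k \<le> N"
  shows "(x, x @ concat (replicate k [a, inv_letter a])) \<in> insertion_eq N"
  using assms(3,4)
proof (induction k arbitrary: x)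
  case 0
  then show ?case by simp
next
  case (Suc k)
  have "[a, inv_letter a] \<in> Q"
    using trivial_relator[OF assms(2)] assms(1) by blast
  then have "(x, x @ [a, inv_letter a]) \<in> insertion_eq N"
    using insertionI[of x "[]" "[a, inv_letter a]" N] Suc.prems by simp
  also have "(x @ [a, inv_letter a], (x @ [a, inv_letter a]) @ concat (replicate k [a, inv_letter a]))
      \<in> insertion_eq N"
    using Suc.prems assms(2) inv_letter_in_letters by (intro Suc.IH) auto
  finally show ?case
    by simp
qed

end

text \<open>For a rule from \<open>u\<close> to \<open>v\<close>, the sum of the two lengths is the
  length of a relator or 2. This parity invariant later yields an odd relator whenever the word
  problem contains an odd word.\<close>

lemma even_length_rewrite_step:
  assumes "\<And>r. r \<in> R \<Longrightarrow> even (length r)"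
    and "(x, y) \<in> rewrite_step \<Sigma> (U_R A R \<union> U_FG A)"
  shows "even (length x) \<longleftrightarrow> even (length y)"
proof -
  obtain p q u v where xy: "x = p @ u @ q" "y = p @ v @ q" and uv: "(u, v) \<in> U_R A R \<union> U_FG A"
    using assms(2) unfolding rewrite_step_def by blast
  have "even (length u) \<longleftrightarrow> even (length v)"
  proof (cases "(u, v) \<in> U_R A R")
    case True
    then have "even (length u + length v)"
      by (cases rule: U_R_cases) (use assms(1) in \<open>fastforce simp: add.commute\<close>)+
    then show ?thesis by simp
  next
    case False
    then show ?thesis
      using uv by (auto simp: U_FG_def)
  qed
  then show ?thesis
    by (auto simp: xy)
qed

section \<open>The word problem of a presented group\<close>

locale presented_group =
  fixes A :: "'a set" and R :: "'a letter list set" and G :: "('g, 'm) monoid_scheme"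
    and h :: "'a letter list set \<Rightarrow> 'g"
  assumes presentation: "finite_presentation A R G h"
begin

lemma group_hom: "group_hom (free_group A) G h"
  using presentation group_free_group
  by (auto simp: finite_presentation_def epi_def group_hom_def group_hom_axioms_def)

sublocale free: group_hom "free_group A" G h
  by (rule group_hom)

lemma free_class_closed: "u \<in> lists (letters A) \<Longrightarrow> free_class A u \<in> carrier (free_group A)"
  by (auto simp only: carrier_free_group)

lemma h_append:
  assumes "u \<in> lists (letters A)" "v \<in> lists (letters A)"
  shows "h (free_class A (u @ v)) = h (free_class A u) \<otimes>\<^bsub>G\<^esub> h (free_class A v)"
  using assms free.hom_mult[OF free_class_closed free_class_closed] mult_free_group by metis

lemma h_Nil: "h (free_class A []) = \<one>\<^bsub>G\<^esub>"
  using free.hom_one by (simp add: one_free_group)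

lemma h_relator:
  assumes "r \<in> R"
  shows "h (free_class A r) = \<one>\<^bsub>G\<^esub>"
proof -
  let ?F = "free_group A"
  have r: "free_class A r \<in> carrier ?F"
    using assms presentation by (intro free_class_closed) (auto simp: finite_presentation_def)
  \<comment> \<open>Conjugation by the identity exhibits the class of \<open>r\<close> as a
    generator of the normal closure.\<close>
  have "free_class A r = \<one>\<^bsub>?F\<^esub> \<otimes>\<^bsub>?F\<^esub> free_class A r \<otimes>\<^bsub>?F\<^esub> inv\<^bsub>?F\<^esub> \<one>\<^bsub>?F\<^esub>"
    using r by simp
  then have "free_class A r \<in> normal_closure ?F (free_class A ` R)"
    unfolding normal_closure_def using assms by (intro generate.incl) blast
  then show ?thesis
    using presentation by (auto simp: finite_presentation_def kernel_def)
qed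

lemma h_trivial_relator:
  assumes "q \<in> trivial_relators A"
  shows "h (free_class A q) = \<one>\<^bsub>G\<^esub>"
proof -
  obtain a where a: "a \<in> letters A" "q = [a, inv_letter a]"
    using assms by (auto simp: trivial_relators_def)
  \<comment> \<open>For the one-letter word \<open>[inv_letter a]\<close>, cancelling its formal
    inverse against it is cancelling \<open>[a, inv_letter a]\<close>.\<close>
  then have "(q, []) \<in> free_eq A"
    using free_eq_inv_word[of "[inv_letter a]" A] inv_letter_in_letters[OF a(1)]
    by (simp add: inv_word_def)
  then have "free_class A q = free_class A []"
    unfolding free_class_def by (rule equiv_class_eq[OF equiv_free_eq])
  then show ?thesis
    by (simp add: h_Nil)
qed

lemma Nil_in_word_problem: "[] \<in> word_problem A G h"
  by (simp add: word_problem_def h_Nil)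

lemma relator_in_words: "q \<in> R \<union> trivial_relators A \<Longrightarrow> q \<in> lists (letters A)"
  using presentation by (auto simp: finite_presentation_def trivial_relators_def inv_letter_in_letters)

lemma word_problem_relator:
  assumes "q \<in> R \<union> trivial_relators A" "u \<in> lists (letters A)" "v \<in> lists (letters A)"
  shows "u @ q @ v \<in> word_problem A G h \<longleftrightarrow> u @ v \<in> word_problem A G h"
proof -
  have q: "q \<in> lists (letters A)" "h (free_class A q) = \<one>\<^bsub>G\<^esub>"
    using assms(1) relator_in_words h_relator h_trivial_relator by auto
  have "q @ v \<in> lists (letters A)"
    using q assms(3) by simp
  then have "h (free_class A (u @ q @ v)) = h (free_class A (u @ v))"
    using assms(2,3) q free.hom_closed[OF free_class_closed] by (simp only: h_append) simp
  then show ?thesis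
    using assms(2,3) q(1) by (simp add: word_problem_def)
qed

sublocale sound_relator_machine A "R \<union> trivial_relators A" "word_problem A G h"
proof
  show "finite A" "finite (R \<union> trivial_relators A)" "[] \<notin> R \<union> trivial_relators A"
    using presentation
    by (auto simp: finite_presentation_def trivial_relators_def letters_def)
  show "R \<union> trivial_relators A \<subseteq> lists (letters A)"
    using relator_in_words by blast
qed (simp_all only: Nil_in_word_problem word_problem_relator)

text \<open>The additional \<open>2 * K\<close> is released after each rewriting step, so it does
  not accumulate along the derivation.\<close>

lemma filling_insertion_eq:
  assumes "filling_length_le A R G h f" "w \<in> word_problem A G h" "\<And>r. r \<in> R \<Longrightarrow> length r \<le> K"
  shows "(w, []) \<in> insertion_eq (f (length w) + 2 * K)"
proof -
  have "(w, []) \<in> {(x, y) \<in> rewrite_step (letters A) (U_R A R \<union> U_FG A).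
      length x \<le> f (length w) \<and> length y \<le> f (length w)}\<^sup>*"
    using assms(1,2) unfolding filling_length_le_def by blast
  then show ?thesis
  proof induction
    case base
    show ?case by simp
  next
    case (step y z)
    then have "(y, z) \<in> insertion_eq (f (length w) + 2 * K)"
      using assms(3) by (intro rewrite_step_insertion_eq) auto
    with step.IH show ?case
      by (rule insertion_eq_trans)
  qed
qed

text \<open>A derivation from a nonempty word has a first step, and the bound applies to the word it
  starts from.\<close>

lemma length_le_filling:
  assumes "filling_length_le A R G h f" "w \<in> word_problem A G h" "w \<noteq> []"
  shows "length w \<le> f (length w)"
proof -
  have "(w, []) \<in> {(x, y) \<in> rewrite_step (letters A) (U_R A R \<union> U_FG A).
      length x \<le> f (length w) \<and> length y \<le> f (length w)}\<^sup>*"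
    using assms(1,2) unfolding filling_length_le_def by blast
  then show ?thesis
    by (cases rule: converse_rtranclE) (use assms(3) in auto)
qed

lemma exists_odd_relator:
  assumes "filling_length_le A R G h f" "w \<in> word_problem A G h" "odd (length w)"
  obtains r where "r \<in> R" "odd (length r)"
proof -
  have "(w, []) \<in> {(x, y) \<in> rewrite_step (letters A) (U_R A R \<union> U_FG A).
      length x \<le> f (length w) \<and> length y \<le> f (length w)}\<^sup>*"
    using assms(1,2) unfolding filling_length_le_def by blast
  \<comment> \<open>If all relators had even length, oddness would propagate down to the empty
    word.\<close>
  then have "odd (length ([] :: 'a letter list))" if "\<And>r. r \<in> R \<Longrightarrow> even (length r)"
  proof induction
    case base
    show ?case by fact
  next
    case (step y z)
    then show ?case
      using even_length_rewrite_step[of R y z "letters A" A] that by auto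
  qed
  then show ?thesis
    using that by auto
qed

text \<open>The filling length need not be monotone, so a word of length at most \<open>n\<close> is first padded to
  length exactly \<open>2 * n\<close>, using a relator of odd length if its own length is odd.\<close>

lemma pad_word_problem:
  assumes "filling_length_le A R G h f" "w \<in> word_problem A G h" "length w \<le> n" "a \<in> letters A"
    and "\<And>r. r \<in> R \<Longrightarrow> length r \<le> n"
  obtains x where "x \<in> word_problem A G h" "length x = 2 * n" "(w, x) \<in> insertion_eq (2 * n)"
proof -
  have w: "w \<in> lists (letters A)"
    using assms(2) by (simp add: word_problem_def)
  have "\<exists>y. y \<in> lists (letters A) \<and> even (length y) \<and> length y \<le> 2 * n \<and> (w, y) \<in> insertion_eq (2 * n)"
  proof (cases "even (length w)")
    case True
    then show ?thesis
      using assms(3) w by (intro exI[of _ w]) auto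
  next
    case False
    then obtain r where r: "r \<in> R" "odd (length r)"
      using exists_odd_relator assms(1,2) by metis
    \<comment> \<open>Both lengths are at most \<open>n\<close>, so the parity correction fits into
      length \<open>2 * n\<close>.\<close>
    moreover have "length w + length r \<le> 2 * n"
      using assms(3,5) r(1) by fastforce
    moreover from this have "(w, w @ r) \<in> insertion_eq (2 * n)"
      using insertionI[of w "[]" r "2 * n"] w r(1) by simp
    ultimately show ?thesis
      using w relator_in_words[of r] False by (intro exI[of _ "w @ r"]) auto
  qed
  then obtain y where y: "y \<in> lists (letters A)" "even (length y)" "length y \<le> 2 * n"
    "(w, y) \<in> insertion_eq (2 * n)" by blast
  \<comment> \<open>The number of missing letter pairs; it is exact because \<open>length y\<close>
    is even.\<close>
  define k where "k = n - length y div 2"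
  have k: "length y + 2 * k = 2 * n"
    using y(2,3) by (auto simp: k_def elim!: evenE)
  define x where "x = y @ concat (replicate k [a, inv_letter a])"
  have "(y, x) \<in> insertion_eq (2 * n)"
    unfolding x_def using assms(4) y(1) k by (intro pad_insertion_eq) auto
  with y(4) have wx: "(w, x) \<in> insertion_eq (2 * n)"
    by (rule insertion_eq_trans)
  then have "x \<in> word_problem A G h"
    using assms(2) by (rule insertion_eq_invariant) (rule word_problem_relator)
  moreover have "length x = 2 * n"
    using k by (simp add: x_def length_concat sum_list_replicate)
  ultimately show ?thesis
    using that wx by blast
qed

text \<open>Goes from \<open>w\<close> to a padded word \<open>x\<close> of length
  \<open>2 * n\<close> and from there to \<open>[]\<close>, so that \<open>f\<close> is evaluated
  exactly at \<open>2 * n\<close>. The empty word is padded too, since its own filling length may be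
  0.\<close>

lemma word_problem_accepts_in_space:
  assumes "filling_length_le A R G h f" "w \<in> word_problem A G h" "length w \<le> n" "n > 0" "a \<in> letters A"
    and K: "\<And>r. r \<in> R \<Longrightarrow> length r \<le> K" "K \<le> n"
  shows "accepts_in_space machine w ((2 * K + 3) * f (2 * n))"
proof -
  obtain x where x: "x \<in> word_problem A G h" "length x = 2 * n" "(w, x) \<in> insertion_eq (2 * n)"
    using pad_word_problem[OF assms(1-3,5)] K le_trans by metis
  define N where "N = f (2 * n) + 2 * K"
  have "x \<noteq> []"
    using x(2) assms(4) by auto
  then have n: "2 * n \<le> f (2 * n)"
    using length_le_filling[OF assms(1) x(1)] x(2) by simp
  then have "(w, x) \<in> insertion_eq N"
    using x(3) insertion_eq_mono[of "2 * n" N] by (auto simp: N_def)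
  also have "(x, []) \<in> insertion_eq N"
    using filling_insertion_eq[OF assms(1) x(1) K(1)] by (simp add: N_def x(2))
  finally have "accepts_in_space machine w (N + 2)"
    using assms(2,3) n by (intro accepts_in_space_machine) (auto simp: word_problem_def N_def)
  \<comment> \<open>As \<open>f (2 * n)\<close> is positive, the additive constant
    \<open>2 * K + 2\<close> is absorbed into the factor.\<close>
  moreover have "N + 2 \<le> (2 * K + 3) * f (2 * n)"
  proof -
    have "(2 * K + 2) * 1 \<le> (2 * K + 2) * f (2 * n)"
      using n assms(4) by (intro mult_le_mono2) auto
    then show ?thesis
      by (simp add: N_def algebra_simps)
  qed
  ultimately show ?thesis
    unfolding accepts_in_space_def by (meson le_trans)
qed

lemma accepted_language_machine:
  assumes "filling_length_le A R G h f" "a \<in> letters A" "\<And>r. r \<in> R \<Longrightarrow> length r \<le> K"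
  shows "accepted_language machine = word_problem A G h"
proof (intro equalityI subsetI)
  fix w assume "w \<in> accepted_language machine"
  then show "w \<in> word_problem A G h"
    using accepts_machine_imp by (simp add: accepted_language_def machine_def)
next
  fix w assume w: "w \<in> word_problem A G h"
  have "accepts machine w"
    \<comment> \<open>The chosen \<open>n\<close> is positive and bounds both
      \<open>length w\<close> and the relator lengths.\<close>
    using word_problem_accepts_in_space[OF assms(1) w, of "Suc (length w + K)" a K] assms(2,3)
    by (intro accepts_in_space_imp_accepts) auto
  then show "w \<in> accepted_language machine"
    using w by (simp add: accepted_language_def word_problem_def machine_def)
qed

end

theorem proposition5p2:
  fixes A :: "'a set"
    and R :: "'a letter list set"
    and G :: "('g, 'm) monoid_scheme"
    and h :: "'a letter list set \<Rightarrow> 'g"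
    and f :: "nat \<Rightarrow> nat"
  assumes "finite_presentation A R G h"
    and "filling_length_le A R G h f"
  shows "word_problem A G h \<in> SymSpace f"
proof (cases "A = {}")
  case True
  \<comment> \<open>Without letters no padding is possible, and \<open>f\<close> may vanish. A
    machine whose initial state is final accepts the only word in no step, hence in no
    space.\<close>
  define M :: "'a letter turing_machine" where
    "M = \<lparr>input_alphabet = {}, transitions = {}, initial_state = 0, final_states = {0}\<rparr>"
  interpret presented_group A R G h
    by unfold_locales fact
  have "word_problem A G h = {[]}"
    using True Nil_in_word_problem by (auto simp: word_problem_def letters_def)
  moreover have space: "accepts_in_space M [] s" for s
    unfolding accepts_in_space_def
    by (intro exI[of _ "{}"]) (auto simp: M_def final_configs_def initial_config_def)
  moreover have "accepted_language M = {[]}"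
    using accepts_in_space_imp_accepts[OF space]
    by (auto simp: accepted_language_def M_def)
  moreover have "symmetric_turing_machine M"
    by (simp add: M_def symmetric_turing_machine_def turing_machine_def)
  ultimately show ?thesis
    unfolding SymSpace_def by (auto intro!: exI[of _ M] exI[of _ "1 :: nat"])
next
  case False
  then obtain a where a: "a \<in> letters A"
    by (auto simp: letters_def)
  interpret presented_group A R G h
    by unfold_locales fact
  have "finite (length ` R)"
    using assms(1) by (simp add: finite_presentation_def)
  then obtain K where K: "\<And>r. r \<in> R \<Longrightarrow> length r \<le> K"
    by (auto simp: finite_nat_set_iff_bounded_le)
  \<comment> \<open>The threshold \<open>Suc K\<close> makes \<open>n\<close> positive and at least
    the length of every relator.\<close>
  have "\<forall>n\<ge>Suc K. \<forall>w\<in>word_problem A G h. length w \<le> n \<longrightarrow>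
      accepts_in_space machine w ((2 * K + 3) * f (2 * n))"
    using word_problem_accepts_in_space[OF assms(2) _ _ _ a K] by simp
  moreover have "accepted_language machine = word_problem A G h"
    by (rule accepted_language_machine[OF assms(2) a K])
  ultimately show ?thesis
    unfolding SymSpace_def using symmetric_machine
    by (intro CollectI exI[of _ machine] conjI exI[of _ "2 * K + 3"] exI[of _ "2 :: nat"]
        exI[of _ "Suc K"]) auto
qed

end
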